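(* Let $A$ be a simple unital $C^*$-algebra with a unique normalized trace $\tau$. Then $$\mathcal{F}(A)\subset IM_+(\tau_*(K_0(A)))\subset \tau_*(K_0(A))\cap \tau_*(K_0(A))^{-1}\cap\mathbb{R}_+ .$$ In particular, $\tau_*(K_0(A))$ is a $\mathbb{Z}[\mathcal{F}(A)]$-module.
   Context: A normalized trace is a tracial state. $\mathbb{R}^{\times}_+$ is the multiplicative group of positive real numbers, and $Tr$ is the unnormalized trace on $M_n(\mathbb{C})$. The fundamental group of $A$ is $\mathcal{F}(A):=\{\tau\otimes Tr(p)\in\mathbb{R}^{\times}_+ \mid n\in\mathbb{N},\ p \text{ a projection in } M_n(A),\ pM_n(A)p\cong A\}$; it is a multiplicative subgroup of $\mathbb{R}^\times_+$. $\tau_*:K_0(A)\to\mathbb{R}$ is the homomorphism induced by $\tau$, i.e. $\tau_*([p]_0)=\tau\otimes Tr(p)$ for projections $p\in M_n(A)$. For an additive subgroup $E$ of $\mathbb{R}$ containing $\mathbb{Z}$, the inner multiplier group of $E$ is $IM(E)=\{t\in\mathbb{R}^{\times}\mid t\in E,\ t^{-1}\in E,\ tE=E\}$, and $IM_+(E)=IM(E)\cap\mathbb{R}_+$ is the positive inner multiplier group. $E^{-1}$ denotes the set of inverses of the nonzero elements of $E$. $\mathbb{Z}[\mathcal{F}(A)]$ is the integral group ring of $\mathcal{F}(A)$, and the module action is by multiplication of real numbers. *)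

theory Defs
  imports
    "HOL-Library.Nonpos_Ints"
    "HOL-Algebra.Free_Abelian_Groups"
    "Jordan_Normal_Form.Matrix"
begin

section \<open>Unital C*-algebras\<close>

text \<open>
  A nonzero unital C*-algebra is a type of the following class. That \<open>norm 1 = 1\<close>, which comes from
  \<open>real_normed_algebra_1\<close>, is a consequence of the C*-identity for a nonzero algebra.
\<close>

class unital_cstar_algebra = real_normed_algebra_1 + banach +
  fixes scaleC :: "complex \<Rightarrow> 'a \<Rightarrow> 'a"  (infixr \<open>*\<^sub>C\<close> 75)
    and star :: "'a \<Rightarrow> 'a"
  assumes scaleC_of_real: "complex_of_real r *\<^sub>C x = r *\<^sub>R x"
    and scaleC_add_right: "c *\<^sub>C (x + y) = c *\<^sub>C x + c *\<^sub>C y"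
    and scaleC_add_left: "(c + d) *\<^sub>C x = c *\<^sub>C x + d *\<^sub>C x"
    and scaleC_scaleC: "c *\<^sub>C (d *\<^sub>C x) = (c * d) *\<^sub>C x"
    and mult_scaleC_left: "(c *\<^sub>C x) * y = c *\<^sub>C (x * y)"
    and mult_scaleC_right: "x * (c *\<^sub>C y) = c *\<^sub>C (x * y)"
    and norm_scaleC: "norm (c *\<^sub>C x) = cmod c * norm x"
    and star_star: "star (star x) = x"
    and star_add: "star (x + y) = star x + star y"
    and star_scaleC: "star (c *\<^sub>C x) = cnj c *\<^sub>C star x"
    and star_mult: "star (x * y) = star y * star x"
    and cstar_identity: "norm (star x * x) = (norm x)\<^sup>2"

text \<open>Closure under scalars is automatic, since \<open>c *\<^sub>C x = (c *\<^sub>C 1) * x\<close>.\<close>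

definition closed_ideal :: "'a::unital_cstar_algebra set \<Rightarrow> bool" where
  "closed_ideal I \<longleftrightarrow> closed I \<and> 0 \<in> I \<and> (\<forall>x\<in>I. \<forall>y\<in>I. x + y \<in> I) \<and>
     (\<forall>x\<in>I. \<forall>a. a * x \<in> I \<and> x * a \<in> I)"

definition simple_cstar :: "'a::unital_cstar_algebra itself \<Rightarrow> bool" where
  "simple_cstar _ \<longleftrightarrow> (\<forall>I :: 'a set. closed_ideal I \<longrightarrow> I = {0} \<or> I = UNIV)"

definition tracial_state :: "('a::unital_cstar_algebra \<Rightarrow> complex) \<Rightarrow> bool" where
  "tracial_state \<tau> \<longleftrightarrow>
     (\<forall>x y. \<tau> (x + y) = \<tau> x + \<tau> y) \<and>
     (\<forall>c x. \<tau> (c *\<^sub>C x) = c * \<tau> x) \<and>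
     (\<forall>x. \<tau> (star x * x) \<in> \<real>\<^sub>\<ge>\<^sub>0) \<and>
     \<tau> 1 = 1 \<and>
     (\<forall>x y. \<tau> (x * y) = \<tau> (y * x))"

definition unique_tracial_state :: "('a::unital_cstar_algebra \<Rightarrow> complex) \<Rightarrow> bool" where
  "unique_tracial_state \<tau> \<longleftrightarrow> tracial_state \<tau> \<and> (\<forall>\<sigma>. tracial_state \<sigma> \<longrightarrow> \<sigma> = \<tau>)"

section \<open>Matrices over a C*-algebra\<close>

definition mat_star :: "'a::unital_cstar_algebra mat \<Rightarrow> 'a mat" where
  "mat_star A = map_mat star (transpose_mat A)"

definition projections :: "nat \<Rightarrow> 'a::unital_cstar_algebra mat set" where
  "projections n = {p \<in> carrier_mat n n. p * p = p \<and> mat_star p = p}"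

definition tensor_Tr :: "('a::unital_cstar_algebra \<Rightarrow> complex) \<Rightarrow> 'a mat \<Rightarrow> complex" where
  "tensor_Tr \<tau> A = (\<Sum>i<dim_row A. \<tau> (A $$ (i, i)))"

definition corner :: "nat \<Rightarrow> 'a::unital_cstar_algebra mat \<Rightarrow> 'a mat set" where
  "corner n p = {p * A * p | A. A \<in> carrier_mat n n}"

text \<open>
  Isomorphism of \<open>p M\<^sub>n(A) p\<close> with \<open>A\<close> as C*-algebras, i.e. a bijective *-homomorphism; such a map is
  automatically isometric, so the norm of \<open>M\<^sub>n(A)\<close> does not occur.
\<close>

definition corner_iso :: "nat \<Rightarrow> 'a::unital_cstar_algebra mat \<Rightarrow> bool" where
  "corner_iso n p \<longleftrightarrow> (\<exists>\<phi>.
     bij_betw \<phi> (corner n p) (UNIV :: 'a set) \<and>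
     (\<forall>x\<in>corner n p. \<forall>y\<in>corner n p. \<phi> (x + y) = \<phi> x + \<phi> y \<and> \<phi> (x * y) = \<phi> x * \<phi> y) \<and>
     (\<forall>x\<in>corner n p. (\<forall>c. \<phi> (map_mat (scaleC c) x) = c *\<^sub>C \<phi> x) \<and> \<phi> (mat_star x) = star (\<phi> x)))"

definition fundamental_group :: "('a::unital_cstar_algebra \<Rightarrow> complex) \<Rightarrow> real set" where
  "fundamental_group \<tau> = {t. t > 0 \<and>
     (\<exists>n p. p \<in> projections n \<and> corner_iso n p \<and> complex_of_real t = tensor_Tr \<tau> p)}"

section \<open>The group \<open>K\<^sub>0\<close>\<close>

definition all_projections :: "'a::unital_cstar_algebra mat set" where
  "all_projections = (\<Union>n. projections n)"

text \<open>Murray--von Neumann equivalence, between projections of possibly different sizes.\<close>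

definition mvn_equiv :: "'a::unital_cstar_algebra mat \<Rightarrow> 'a mat \<Rightarrow> bool" where
  "mvn_equiv p q \<longleftrightarrow>
     (\<exists>v \<in> carrier_mat (dim_row q) (dim_row p). p = mat_star v * v \<and> q = v * mat_star v)"

definition block_sum :: "'a::unital_cstar_algebra mat \<Rightarrow> 'a mat \<Rightarrow> 'a mat"  (infixl \<open>\<oplus>\<^sub>m\<close> 65) where
  "p \<oplus>\<^sub>m q = four_block_mat p (0\<^sub>m (dim_row p) (dim_col q)) (0\<^sub>m (dim_row q) (dim_col p)) q"

text \<open>
  For unital \<open>A\<close>, \<open>K\<^sub>0(A)\<close> is the Grothendieck group of the semigroup of Murray--von Neumann classes of
  projections in matrices over \<open>A\<close>. Its elements are classes of pairs \<open>(p, q)\<close> of projections,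
  where \<open>(p, q)\<close> stands for the formal difference \<open>[p]\<^sub>0 - [q]\<^sub>0\<close>.
\<close>

definition K0_rel :: "(('a::unital_cstar_algebra mat \<times> 'a mat) \<times> ('a mat \<times> 'a mat)) set" where
  "K0_rel = {((p, q), (p', q')).
     p \<in> all_projections \<and> q \<in> all_projections \<and> p' \<in> all_projections \<and> q' \<in> all_projections \<and>
     (\<exists>r\<in>all_projections. mvn_equiv (p \<oplus>\<^sub>m q' \<oplus>\<^sub>m r) (p' \<oplus>\<^sub>m q \<oplus>\<^sub>m r))}"

definition K0 :: "('a::unital_cstar_algebra mat \<times> 'a mat) set monoid" where
  "K0 = \<lparr>carrier = (all_projections \<times> all_projections) // K0_rel,
         monoid.mult = (\<lambda>x y. \<Union>(p, q)\<in>x. \<Union>(p', q')\<in>y. K0_rel `` {(p \<oplus>\<^sub>m p', q \<oplus>\<^sub>m q')}),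
         one = K0_rel `` {(0\<^sub>m 0 0, 0\<^sub>m 0 0)}\<rparr>"

definition K0_class :: "'a::unital_cstar_algebra mat \<Rightarrow> ('a mat \<times> 'a mat) set" where
  "K0_class p = K0_rel `` {(p, 0\<^sub>m 0 0)}"

text \<open>
  The homomorphism \<open>\<tau>\<^sub>*\<close> on \<open>K\<^sub>0\<close> induced by \<open>\<tau>\<close>. Real parts are taken only to land in \<open>real\<close>: the
  number \<open>tensor_Tr \<tau> p\<close> is real for a tracial state \<open>\<tau>\<close> and a projection \<open>p\<close>. The value does not
  depend on the representing pair; see \<open>K0_map_hom\<close> and \<open>K0_map_class\<close> below.
\<close>

definition K0_map :: "('a::unital_cstar_algebra \<Rightarrow> complex) \<Rightarrow> ('a mat \<times> 'a mat) set \<Rightarrow> real" where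
  "K0_map \<tau> x = the_elem ((\<lambda>(p, q). Re (tensor_Tr \<tau> p) - Re (tensor_Tr \<tau> q)) ` x)"

abbreviation K0_image :: "('a::unital_cstar_algebra \<Rightarrow> complex) \<Rightarrow> real set" where
  "K0_image \<tau> \<equiv> K0_map \<tau> ` carrier K0"

subsection \<open>Well-definedness\<close>

lemma star_zero [simp]: "star (0::'a::unital_cstar_algebra) = 0"
  using star_add[of 0 "0::'a"] by simp

lemma star_sum: "star (\<Sum>i\<in>I. f i) = (\<Sum>i\<in>I. star (f i :: 'a::unital_cstar_algebra))"
  by (induction I rule: infinite_finite_induct) (auto simp: star_add)

lemma mat_star_dim [simp]:
  "dim_row (mat_star A) = dim_col A" "dim_col (mat_star A) = dim_row A"
  by (simp_all add: mat_star_def)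

lemma mat_star_carrier [simp]: "mat_star A \<in> carrier_mat n m \<longleftrightarrow> A \<in> carrier_mat m n"
  unfolding carrier_mat_def mem_Collect_eq mat_star_dim by (rule conj_commute)

lemma mat_star_index [simp]:
  "i < dim_col A \<Longrightarrow> j < dim_row A \<Longrightarrow> mat_star A $$ (i, j) = star (A $$ (j, i))"
  by (auto simp: mat_star_def)

lemma mat_star_star [simp]: "mat_star (mat_star A) = A"
  by (rule eq_matI) (auto simp: star_star)

lemma mat_star_mult:
  "dim_col A = dim_row B \<Longrightarrow> mat_star (A * B) = mat_star B * mat_star A"
  by (rule eq_matI) (auto simp: scalar_prod_def star_sum star_mult)

lemma block_sum_dim [simp]:
  "dim_row (p \<oplus>\<^sub>m q) = dim_row p + dim_row q" "dim_col (p \<oplus>\<^sub>m q) = dim_col p + dim_col q"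
  by (auto simp: block_sum_def)

lemma block_sum_assoc: "(p \<oplus>\<^sub>m q) \<oplus>\<^sub>m r = p \<oplus>\<^sub>m (q \<oplus>\<^sub>m r)"
  unfolding block_sum_def by (rule assoc_four_block_mat[symmetric])

lemma block_sum_star: "mat_star (p \<oplus>\<^sub>m q) = mat_star p \<oplus>\<^sub>m mat_star q"
  by (rule eq_matI) (auto simp: block_sum_def)

lemma block_sum_mult:
  assumes "dim_col a = dim_row c" "dim_col b = dim_row d"
  shows "(a \<oplus>\<^sub>m b) * (c \<oplus>\<^sub>m d) = (a * c) \<oplus>\<^sub>m (b * d)"
proof -
  define i j k l m n where "i = dim_row a" "j = dim_row c" "k = dim_col c"
    "l = dim_row b" "m = dim_row d" "n = dim_col d"
  then have c: "a \<in> carrier_mat i j" "c \<in> carrier_mat j k" "b \<in> carrier_mat l m" "d \<in> carrier_mat m n"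
    using assms by auto
  show ?thesis
    unfolding block_sum_def
    by (subst mult_four_block_mat[of _ i j _ m _ l _ _ k _ n])
       (use c in \<open>auto intro!: cong_four_block_mat\<close>)
qed

lemma all_projections_iff:
  "p \<in> all_projections \<longleftrightarrow> dim_col p = dim_row p \<and> p * p = p \<and> mat_star p = p"
  by (auto simp: all_projections_def projections_def)

lemma all_projections_block_sum [intro]:
  "p \<in> all_projections \<Longrightarrow> q \<in> all_projections \<Longrightarrow> p \<oplus>\<^sub>m q \<in> all_projections"
  by (auto simp: all_projections_iff block_sum_mult block_sum_star)

lemma all_projections_zero [simp, intro]: "0\<^sub>m 0 0 \<in> all_projections"
  by (auto simp: all_projections_iff)

lemma block_sum_zero [simp]: "p \<oplus>\<^sub>m 0\<^sub>m 0 0 = p" "0\<^sub>m 0 0 \<oplus>\<^sub>m p = p"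
  by (auto simp: block_sum_def intro!: eq_matI)

lemma mvn_equiv_refl: "p \<in> all_projections \<Longrightarrow> mvn_equiv p p"
  unfolding mvn_equiv_def by (rule bexI[of _ p]) (auto simp: all_projections_iff)

lemma mvn_equiv_sym: "mvn_equiv p q \<Longrightarrow> mvn_equiv q p"
  unfolding mvn_equiv_def
proof (elim bexE conjE)
  fix v assume v: "v \<in> carrier_mat (dim_row q) (dim_row p)" "p = mat_star v * v" "q = v * mat_star v"
  show "\<exists>v\<in>carrier_mat (dim_row p) (dim_row q). q = mat_star v * v \<and> p = v * mat_star v"
    by (rule bexI[of _ "mat_star v"]) (use v in simp_all)
qed

lemma mvn_equiv_trans:
  assumes pq: "mvn_equiv p q" and qr: "mvn_equiv q r" and P: "p \<in> all_projections" "r \<in> all_projections"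
  shows "mvn_equiv p r"
proof -
  from pq obtain v where v: "v \<in> carrier_mat (dim_row q) (dim_row p)"
      "p = mat_star v * v" "q = v * mat_star v"
    unfolding mvn_equiv_def by blast
  from qr obtain w where w: "w \<in> carrier_mat (dim_row r) (dim_row q)"
      "q = mat_star w * w" "r = w * mat_star w"
    unfolding mvn_equiv_def by blast
  define n where "n = dim_row p"
  define m where "m = dim_row q"
  define k where "k = dim_row r"
  have vc: "v \<in> carrier_mat m n" "mat_star v \<in> carrier_mat n m"
    and wc: "w \<in> carrier_mat k m" "mat_star w \<in> carrier_mat m k"
    using v(1) w(1) by (auto simp: n_def m_def k_def)
  have s: "mat_star (w * v) = mat_star v * mat_star w"
    using vc wc by (intro mat_star_mult) auto
  have "mat_star (w * v) * (w * v) = mat_star v * (mat_star w * w * v)"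
    unfolding s using vc wc
    by (simp add: assoc_mult_mat[of _ n m _ k _ n] assoc_mult_mat[of _ m k _ m _ n])
  also have "\<dots> = mat_star v * (v * mat_star v * v)"
    using w(2) v(3) by simp
  also have "\<dots> = p * p"
    unfolding v(2) using vc
    by (simp add: assoc_mult_mat[of _ n m _ n _ n] assoc_mult_mat[of _ m n _ m _ n])
  also have "\<dots> = p"
    using P by (simp add: all_projections_iff)
  finally have 1: "p = mat_star (w * v) * (w * v)" by simp
  have "(w * v) * mat_star (w * v) = w * (v * mat_star v * mat_star w)"
    unfolding s using vc wc
    by (simp add: assoc_mult_mat[of _ k m _ n _ k] assoc_mult_mat[of _ m n _ m _ k])
  also have "\<dots> = w * (mat_star w * w * mat_star w)"
    using w(2) v(3) by simp
  also have "\<dots> = r * r"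
    unfolding w(3) using wc
    by (simp add: assoc_mult_mat[of _ k m _ k _ k] assoc_mult_mat[of _ m k _ m _ k])
  also have "\<dots> = r"
    using P by (simp add: all_projections_iff)
  finally have 2: "r = (w * v) * mat_star (w * v)" by simp
  have "w * v \<in> carrier_mat (dim_row r) (dim_row p)"
    using mult_carrier_mat[OF wc(1) vc(1)] by (simp add: n_def k_def)
  then show ?thesis
    unfolding mvn_equiv_def using 1 2 by blast
qed

lemma mvn_equiv_block_sum:
  assumes "mvn_equiv p p'" "mvn_equiv q q'"
  shows "mvn_equiv (p \<oplus>\<^sub>m q) (p' \<oplus>\<^sub>m q')"
proof -
  from assms obtain v w where v: "v \<in> carrier_mat (dim_row p') (dim_row p)"
      "p = mat_star v * v" "p' = v * mat_star v"
    and w: "w \<in> carrier_mat (dim_row q') (dim_row q)"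
      "q = mat_star w * w" "q' = w * mat_star w"
    unfolding mvn_equiv_def by blast
  have "p \<oplus>\<^sub>m q = mat_star (v \<oplus>\<^sub>m w) * (v \<oplus>\<^sub>m w)"
    unfolding block_sum_star by (subst block_sum_mult) (use v w in auto)
  moreover have "p' \<oplus>\<^sub>m q' = (v \<oplus>\<^sub>m w) * mat_star (v \<oplus>\<^sub>m w)"
    unfolding block_sum_star by (subst block_sum_mult) (use v w in auto)
  moreover have "v \<oplus>\<^sub>m w \<in> carrier_mat (dim_row (p' \<oplus>\<^sub>m q')) (dim_row (p \<oplus>\<^sub>m q))"
    using v(1) w(1) by (intro carrier_matI) auto
  ultimately show ?thesis
    unfolding mvn_equiv_def by blast
qed

lemma mvn_equiv_block_sum_commute:
  assumes "p \<in> all_projections" "q \<in> all_projections"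
  shows "mvn_equiv (p \<oplus>\<^sub>m q) (q \<oplus>\<^sub>m p)"
proof -
  define n m where "n = dim_row p" and "m = dim_row q"
  have c: "p \<in> carrier_mat n n" "q \<in> carrier_mat m m"
    using assms by (auto simp: all_projections_iff n_def m_def)
  have pq: "p * p = p" "q * q = q" "mat_star p = p" "mat_star q = q"
    using assms by (auto simp: all_projections_iff)
  define v where "v = four_block_mat (0\<^sub>m m n) q p (0\<^sub>m n m)"
  have ent: "star (p $$ (j, i)) = p $$ (i, j)" if "i < n" "j < n" for i j
    using mat_star_index[of i p j] pq c that by auto
  have ent': "star (q $$ (j, i)) = q $$ (i, j)" if "i < m" "j < m" for i j
    using mat_star_index[of i q j] pq c that by auto
  have vs: "mat_star v = four_block_mat (0\<^sub>m n m) p q (0\<^sub>m m n)"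
    by (rule eq_matI) (use c in \<open>auto simp: v_def ent ent'\<close>)
  have "mat_star v * v = p \<oplus>\<^sub>m q"
    unfolding vs block_sum_def unfolding v_def
    by (subst mult_four_block_mat[of _ n m _ n _ m])
       (use c pq in \<open>auto intro!: cong_four_block_mat\<close>)
  moreover have "v * mat_star v = q \<oplus>\<^sub>m p"
    unfolding vs block_sum_def unfolding v_def
    by (subst mult_four_block_mat[of _ m n _ m _ n])
       (use c pq in \<open>auto intro!: cong_four_block_mat\<close>)
  moreover have "v \<in> carrier_mat (dim_row (q \<oplus>\<^sub>m p)) (dim_row (p \<oplus>\<^sub>m q))"
    using c by (auto simp: v_def)
  ultimately show ?thesis
    unfolding mvn_equiv_def by metis
qed

definition mvn_class :: "'a::unital_cstar_algebra mat \<Rightarrow> 'a mat set" where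
  "mvn_class p = {s \<in> all_projections. mvn_equiv p s}"

definition mvn_add :: "'a::unital_cstar_algebra mat set \<Rightarrow> 'a mat set \<Rightarrow> 'a mat set" where
  "mvn_add X Y = {s \<in> all_projections. \<exists>p\<in>X \<inter> all_projections. \<exists>q\<in>Y \<inter> all_projections.
     mvn_equiv (p \<oplus>\<^sub>m q) s}"

lemma mvn_class_eq_iff:
  assumes "p \<in> all_projections" "q \<in> all_projections"
  shows "mvn_class p = mvn_class q \<longleftrightarrow> mvn_equiv p q"
proof
  assume "mvn_class p = mvn_class q"
  moreover have "q \<in> mvn_class q"
    using assms by (simp add: mvn_class_def mvn_equiv_refl)
  ultimately show "mvn_equiv p q"
    unfolding mvn_class_def by blast
next
  assume *: "mvn_equiv p q"
  have "mvn_equiv p s \<longleftrightarrow> mvn_equiv q s" if "s \<in> all_projections" for s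
    using assms that * mvn_equiv_sym[OF *] mvn_equiv_trans[of p q s] mvn_equiv_trans[of q p s]
    by blast
  then show "mvn_class p = mvn_class q"
    by (auto simp: mvn_class_def)
qed

lemma mvn_class_block_sum:
  assumes "p \<in> all_projections" "q \<in> all_projections"
  shows "mvn_class (p \<oplus>\<^sub>m q) = mvn_add (mvn_class p) (mvn_class q)"
proof (intro equalityI subsetI)
  fix s assume "s \<in> mvn_class (p \<oplus>\<^sub>m q)"
  then show "s \<in> mvn_add (mvn_class p) (mvn_class q)"
    using assms mvn_equiv_refl by (auto simp: mvn_class_def mvn_add_def)
next
  fix s assume "s \<in> mvn_add (mvn_class p) (mvn_class q)"
  then obtain p' q' where *: "s \<in> all_projections" "p' \<in> all_projections" "q' \<in> all_projections"
      "mvn_equiv p p'" "mvn_equiv q q'" "mvn_equiv (p' \<oplus>\<^sub>m q') s"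
    by (auto simp: mvn_class_def mvn_add_def)
  then show "s \<in> mvn_class (p \<oplus>\<^sub>m q)"
    using assms mvn_equiv_block_sum[of p p' q q'] mvn_equiv_trans[of "p \<oplus>\<^sub>m q" "p' \<oplus>\<^sub>m q'" s]
    by (auto simp: mvn_class_def)
qed

lemma mvn_add_commute: "mvn_add X Y = mvn_add Y X"
proof -
  have "mvn_add X Y \<subseteq> mvn_add Y X" for X Y :: "'a mat set"
  proof
    fix s assume "s \<in> mvn_add X Y"
    then obtain p q where *: "s \<in> all_projections" "p \<in> all_projections" "q \<in> all_projections"
      "p \<in> X" "q \<in> Y" "mvn_equiv (p \<oplus>\<^sub>m q) s"
      by (auto simp: mvn_add_def)
    then have "mvn_equiv (q \<oplus>\<^sub>m p) s"
      using mvn_equiv_block_sum_commute mvn_equiv_trans all_projections_block_sum by metis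
    with * show "s \<in> mvn_add Y X"
      by (auto simp: mvn_add_def)
  qed
  then show ?thesis by blast
qed

lemma mvn_add_add:
  "mvn_add (mvn_add X Y) Z = {s \<in> all_projections. \<exists>p\<in>X \<inter> all_projections.
     \<exists>q\<in>Y \<inter> all_projections. \<exists>r\<in>Z \<inter> all_projections. mvn_equiv (p \<oplus>\<^sub>m q \<oplus>\<^sub>m r) s}"
  (is "?L = ?R")
proof (intro equalityI subsetI)
  fix s assume "s \<in> ?L"
  then obtain p q u r where *: "s \<in> all_projections" "p \<in> X \<inter> all_projections"
      "q \<in> Y \<inter> all_projections" "r \<in> Z \<inter> all_projections"
      "u \<in> all_projections" "mvn_equiv (p \<oplus>\<^sub>m q) u" "mvn_equiv (u \<oplus>\<^sub>m r) s"
    by (auto simp: mvn_add_def)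
  then have "mvn_equiv (p \<oplus>\<^sub>m q \<oplus>\<^sub>m r) (u \<oplus>\<^sub>m r)"
    by (auto intro: mvn_equiv_block_sum mvn_equiv_refl)
  then have "mvn_equiv (p \<oplus>\<^sub>m q \<oplus>\<^sub>m r) s"
    using * by (auto intro: mvn_equiv_trans)
  with * show "s \<in> ?R" by blast
next
  fix s assume "s \<in> ?R"
  then obtain p q r where *: "s \<in> all_projections" "p \<in> X \<inter> all_projections"
      "q \<in> Y \<inter> all_projections" "r \<in> Z \<inter> all_projections" "mvn_equiv (p \<oplus>\<^sub>m q \<oplus>\<^sub>m r) s"
    by blast
  then have "p \<oplus>\<^sub>m q \<in> mvn_add X Y"
    by (auto simp: mvn_add_def intro: mvn_equiv_refl)
  with * show "s \<in> ?L"
    unfolding mvn_add_def[of _ Z] by blast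
qed

lemma mvn_add_assoc: "mvn_add (mvn_add X Y) Z = mvn_add X (mvn_add Y Z)"
proof -
  have "mvn_add X (mvn_add Y Z) = mvn_add (mvn_add Z Y) X"
    by (subst mvn_add_commute, subst (2) mvn_add_commute) (rule refl)
  also have "\<dots> = mvn_add (mvn_add X Y) Z"
    unfolding mvn_add_add
  proof (rule Collect_cong, intro conj_cong refl iffI; elim bexE)
    fix s p q r assume s: "s \<in> all_projections" and *: "p \<in> Z \<inter> all_projections"
      "q \<in> Y \<inter> all_projections" "r \<in> X \<inter> all_projections" "mvn_equiv (p \<oplus>\<^sub>m q \<oplus>\<^sub>m r) s"
    have "mvn_equiv (r \<oplus>\<^sub>m q \<oplus>\<^sub>m p) (p \<oplus>\<^sub>m (r \<oplus>\<^sub>m q))"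
      using * by (auto intro: mvn_equiv_block_sum_commute)
    moreover have "mvn_equiv (p \<oplus>\<^sub>m (r \<oplus>\<^sub>m q)) (p \<oplus>\<^sub>m (q \<oplus>\<^sub>m r))"
      using * by (auto intro: mvn_equiv_block_sum_commute mvn_equiv_block_sum mvn_equiv_refl)
    ultimately have "mvn_equiv (r \<oplus>\<^sub>m q \<oplus>\<^sub>m p) s"
      using * s by (metis IntE all_projections_block_sum block_sum_assoc mvn_equiv_trans)
    then show "\<exists>p\<in>X \<inter> all_projections. \<exists>q\<in>Y \<inter> all_projections. \<exists>r\<in>Z \<inter> all_projections.
        mvn_equiv (p \<oplus>\<^sub>m q \<oplus>\<^sub>m r) s"
      using * by blast
  next
    fix s p q r assume s: "s \<in> all_projections" and *: "p \<in> X \<inter> all_projections"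
      "q \<in> Y \<inter> all_projections" "r \<in> Z \<inter> all_projections" "mvn_equiv (p \<oplus>\<^sub>m q \<oplus>\<^sub>m r) s"
    have "mvn_equiv (r \<oplus>\<^sub>m q \<oplus>\<^sub>m p) (p \<oplus>\<^sub>m (r \<oplus>\<^sub>m q))"
      using * by (auto intro: mvn_equiv_block_sum_commute)
    moreover have "mvn_equiv (p \<oplus>\<^sub>m (r \<oplus>\<^sub>m q)) (p \<oplus>\<^sub>m (q \<oplus>\<^sub>m r))"
      using * by (auto intro: mvn_equiv_block_sum_commute mvn_equiv_block_sum mvn_equiv_refl)
    ultimately have "mvn_equiv (r \<oplus>\<^sub>m q \<oplus>\<^sub>m p) s"
      using * s by (metis IntE all_projections_block_sum block_sum_assoc mvn_equiv_trans)
    then show "\<exists>p\<in>Z \<inter> all_projections. \<exists>q\<in>Y \<inter> all_projections. \<exists>r\<in>X \<inter> all_projections.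
        mvn_equiv (p \<oplus>\<^sub>m q \<oplus>\<^sub>m r) s"
      using * by blast
  qed
  finally show ?thesis by simp
qed

lemma mvn_add_left_commute: "mvn_add X (mvn_add Y Z) = mvn_add Y (mvn_add X Z)"
proof -
  have "mvn_add (mvn_add X Y) Z = mvn_add (mvn_add Y X) Z"
    by (rule arg_cong2[OF mvn_add_commute refl])
  then show ?thesis
    by (simp only: mvn_add_assoc)
qed

lemmas mvn_add_ac = mvn_add_assoc mvn_add_commute mvn_add_left_commute

lemma K0_rel_iff:
  "((p, q), (p', q')) \<in> K0_rel \<longleftrightarrow>
     p \<in> all_projections \<and> q \<in> all_projections \<and> p' \<in> all_projections \<and> q' \<in> all_projections \<and>
     (\<exists>r\<in>all_projections. mvn_add (mvn_class p) (mvn_add (mvn_class q') (mvn_class r)) =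
        mvn_add (mvn_class p') (mvn_add (mvn_class q) (mvn_class r)))"
proof -
  have "mvn_equiv (p \<oplus>\<^sub>m q' \<oplus>\<^sub>m r) (p' \<oplus>\<^sub>m q \<oplus>\<^sub>m r) \<longleftrightarrow>
      mvn_add (mvn_class p) (mvn_add (mvn_class q') (mvn_class r)) =
        mvn_add (mvn_class p') (mvn_add (mvn_class q) (mvn_class r))"
    if "p \<in> all_projections" "q \<in> all_projections" "p' \<in> all_projections" "q' \<in> all_projections"
      "r \<in> all_projections" for r
    using that mvn_class_eq_iff[of "p \<oplus>\<^sub>m q' \<oplus>\<^sub>m r" "p' \<oplus>\<^sub>m q \<oplus>\<^sub>m r"]
    by (simp add: mvn_class_block_sum all_projections_block_sum mvn_add_assoc)
  then show ?thesis
    by (auto simp: K0_rel_def)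
qed

lemma K0_rel_equiv: "equiv (all_projections \<times> all_projections) K0_rel"
  (is "equiv ?A (?R :: (('a mat \<times> 'a mat) \<times> ('a mat \<times> 'a mat)) set)")
proof (rule equivI)
  show "?R \<subseteq> ?A \<times> ?A"
    by (auto simp: K0_rel_def)
  show "refl_on ?A ?R"
    by (rule refl_onI) (auto simp: K0_rel_iff)
  show "sym ?R"
    by (rule symI) (force simp: K0_rel_iff)
  show "trans ?R"
  proof (rule transI, clarify)
    fix p q p' q' p'' q'' :: "'a mat"
    assume a: "((p, q), (p', q')) \<in> K0_rel" and b: "((p', q'), (p'', q'')) \<in> K0_rel"
    from a obtain r where r: "r \<in> all_projections"
      "mvn_add (mvn_class p) (mvn_add (mvn_class q') (mvn_class r)) =
        mvn_add (mvn_class p') (mvn_add (mvn_class q) (mvn_class r))"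
      by (auto simp: K0_rel_iff)
    from b obtain s where s: "s \<in> all_projections"
      "mvn_add (mvn_class p') (mvn_add (mvn_class q'') (mvn_class s)) =
        mvn_add (mvn_class p'') (mvn_add (mvn_class q') (mvn_class s))"
      by (auto simp: K0_rel_iff)
    have P: "p \<in> all_projections" "q \<in> all_projections" "p' \<in> all_projections"
        "q' \<in> all_projections" "p'' \<in> all_projections" "q'' \<in> all_projections"
      using a b by (auto simp: K0_rel_iff)
    let ?P = "mvn_class p" and ?Q = "mvn_class q" and ?P' = "mvn_class p'" and ?Q' = "mvn_class q'"
      and ?P'' = "mvn_class p''" and ?Q'' = "mvn_class q''" and ?R = "mvn_class r"
      and ?S = "mvn_class s"
    let ?T = "mvn_class (p' \<oplus>\<^sub>m q' \<oplus>\<^sub>m r \<oplus>\<^sub>m s)"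
    have T: "?T = mvn_add (mvn_add (mvn_add ?P' ?Q') ?R) ?S"
      using P r s by (simp add: mvn_class_block_sum all_projections_block_sum)
    have "mvn_add ?P (mvn_add ?Q'' ?T) =
      mvn_add (mvn_add ?P (mvn_add ?Q' ?R)) (mvn_add ?P' (mvn_add ?Q'' ?S))"
      unfolding T by (simp only: mvn_add_ac)
    also have "\<dots> = mvn_add (mvn_add ?P' (mvn_add ?Q ?R)) (mvn_add ?P'' (mvn_add ?Q' ?S))"
      using r s by simp
    also have "\<dots> = mvn_add ?P'' (mvn_add ?Q ?T)"
      unfolding T by (simp only: mvn_add_ac)
    finally have "mvn_add ?P (mvn_add ?Q'' ?T) = mvn_add ?P'' (mvn_add ?Q ?T)" .
    moreover have "p' \<oplus>\<^sub>m q' \<oplus>\<^sub>m r \<oplus>\<^sub>m s \<in> all_projections"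
      using P r s by (intro all_projections_block_sum)
    ultimately show "((p, q), (p'', q'')) \<in> K0_rel"
      using P unfolding K0_rel_iff by blast
  qed
qed

lemma K0_rel_block_sum:
  assumes a: "((p, q), (p', q')) \<in> K0_rel" and b: "((u, v), (u', v')) \<in> K0_rel"
  shows "((p \<oplus>\<^sub>m u, q \<oplus>\<^sub>m v), (p' \<oplus>\<^sub>m u', q' \<oplus>\<^sub>m v')) \<in> K0_rel"
proof -
  from a obtain r where r: "r \<in> all_projections"
    "mvn_add (mvn_class p) (mvn_add (mvn_class q') (mvn_class r)) =
      mvn_add (mvn_class p') (mvn_add (mvn_class q) (mvn_class r))"
    by (auto simp: K0_rel_iff)
  from b obtain s where s: "s \<in> all_projections"
    "mvn_add (mvn_class u) (mvn_add (mvn_class v') (mvn_class s)) =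
      mvn_add (mvn_class u') (mvn_add (mvn_class v) (mvn_class s))"
    by (auto simp: K0_rel_iff)
  have P: "p \<in> all_projections" "q \<in> all_projections" "p' \<in> all_projections"
      "q' \<in> all_projections" "u \<in> all_projections" "v \<in> all_projections"
      "u' \<in> all_projections" "v' \<in> all_projections"
    using a b by (auto simp: K0_rel_iff)
  have "mvn_add (mvn_class (p \<oplus>\<^sub>m u)) (mvn_add (mvn_class (q' \<oplus>\<^sub>m v')) (mvn_class (r \<oplus>\<^sub>m s))) =
    mvn_add (mvn_add (mvn_class p) (mvn_add (mvn_class q') (mvn_class r)))
      (mvn_add (mvn_class u) (mvn_add (mvn_class v') (mvn_class s)))"
    unfolding mvn_class_block_sum[OF P(1,5)] mvn_class_block_sum[OF P(4,8)]
      mvn_class_block_sum[OF r(1) s(1)] by (simp only: mvn_add_ac)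
  also have "\<dots> = mvn_add (mvn_add (mvn_class p') (mvn_add (mvn_class q) (mvn_class r)))
      (mvn_add (mvn_class u') (mvn_add (mvn_class v) (mvn_class s)))"
    using r s by simp
  also have "\<dots> = mvn_add (mvn_class (p' \<oplus>\<^sub>m u'))
      (mvn_add (mvn_class (q \<oplus>\<^sub>m v)) (mvn_class (r \<oplus>\<^sub>m s)))"
    unfolding mvn_class_block_sum[OF P(3,7)] mvn_class_block_sum[OF P(2,6)]
      mvn_class_block_sum[OF r(1) s(1)] by (simp only: mvn_add_ac)
  finally show ?thesis
    using P r(1) s(1) unfolding K0_rel_iff by (blast intro: all_projections_block_sum)
qed

lemma K0_carrier_cases:
  assumes "x \<in> carrier K0"
  obtains p q where "p \<in> all_projections" "q \<in> all_projections" "x = K0_rel `` {(p, q)}"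
  using assms by (auto simp: K0_def elim!: quotientE)

lemma K0_carrierI:
  "p \<in> all_projections \<Longrightarrow> q \<in> all_projections \<Longrightarrow> K0_rel `` {(p, q)} \<in> carrier K0"
  by (auto simp: K0_def intro: quotientI)

lemma K0_mult:
  assumes "p \<in> all_projections" "q \<in> all_projections" "p' \<in> all_projections" "q' \<in> all_projections"
  shows "K0_rel `` {(p, q)} \<otimes>\<^bsub>K0\<^esub> K0_rel `` {(p', q')} = K0_rel `` {(p \<oplus>\<^sub>m p', q \<oplus>\<^sub>m q')}"
proof -
  let ?c = "K0_rel `` {(p \<oplus>\<^sub>m p', q \<oplus>\<^sub>m q')}"
  have "K0_rel `` {(a \<oplus>\<^sub>m a', b \<oplus>\<^sub>m b')} = ?c"
    if "(a, b) \<in> K0_rel `` {(p, q)}" "(a', b') \<in> K0_rel `` {(p', q')}" for a b a' b'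
    using that K0_rel_block_sum equiv_class_eq[OF K0_rel_equiv] by blast
  moreover have "(p, q) \<in> K0_rel `` {(p, q)}" "(p', q') \<in> K0_rel `` {(p', q')}"
    using assms by (auto simp: K0_rel_iff)
  ultimately show ?thesis
    unfolding K0_def monoid.simps by fastforce
qed

lemma K0_class_eqI:
  assumes "p \<in> all_projections" "q \<in> all_projections" "p' \<in> all_projections" "q' \<in> all_projections"
    and "mvn_add (mvn_class p) (mvn_class q') = mvn_add (mvn_class p') (mvn_class q)"
  shows "K0_rel `` {(p, q)} = K0_rel `` {(p', q')}"
proof (rule equiv_class_eq[OF K0_rel_equiv])
  have "mvn_add (mvn_class p) (mvn_add (mvn_class q') (mvn_class (0\<^sub>m 0 0))) =
      mvn_add (mvn_class p') (mvn_add (mvn_class q) (mvn_class (0\<^sub>m 0 0)))"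
    using assms(5) by (simp only: mvn_add_assoc[symmetric])
  then show "((p, q), (p', q')) \<in> K0_rel"
    using assms unfolding K0_rel_iff by blast
qed

lemma K0_comm_group: "comm_group (K0 :: ('a::unital_cstar_algebra mat \<times> 'a mat) set monoid)"
proof (rule comm_groupI)
  let ?G = "K0 :: ('a mat \<times> 'a mat) set monoid"
  have one: "\<one>\<^bsub>?G\<^esub> = K0_rel `` {(0\<^sub>m 0 0, 0\<^sub>m 0 0)}"
    by (simp add: K0_def)
  show "\<one>\<^bsub>?G\<^esub> \<in> carrier ?G"
    unfolding one by (intro K0_carrierI) auto
  fix x assume "x \<in> carrier ?G"
  then obtain p q where x: "p \<in> all_projections" "q \<in> all_projections" "x = K0_rel `` {(p, q)}"
    by (rule K0_carrier_cases)
  show "\<one>\<^bsub>?G\<^esub> \<otimes>\<^bsub>?G\<^esub> x = x"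
    unfolding one x(3) by (subst K0_mult) (use x in auto)
  have "K0_rel `` {(q, p)} \<otimes>\<^bsub>?G\<^esub> x = \<one>\<^bsub>?G\<^esub>"
    unfolding one x(3) K0_mult[OF x(2,1,1,2)]
    using x by (intro K0_class_eqI)
      (auto simp: mvn_class_block_sum all_projections_block_sum mvn_add_ac)
  then show "\<exists>y\<in>carrier ?G. y \<otimes>\<^bsub>?G\<^esub> x = \<one>\<^bsub>?G\<^esub>"
    using x K0_carrierI by blast
  fix y assume "y \<in> carrier ?G"
  then obtain p' q' where y: "p' \<in> all_projections" "q' \<in> all_projections"
      "y = K0_rel `` {(p', q')}"
    by (rule K0_carrier_cases)
  show "x \<otimes>\<^bsub>?G\<^esub> y \<in> carrier ?G"
    unfolding x(3) y(3) by (subst K0_mult) (use x y in \<open>auto intro: K0_carrierI\<close>)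
  show "x \<otimes>\<^bsub>?G\<^esub> y = y \<otimes>\<^bsub>?G\<^esub> x"
    unfolding x(3) y(3) K0_mult[OF x(1,2) y(1,2)] K0_mult[OF y(1,2) x(1,2)]
    by (intro K0_class_eqI) (use x y in \<open>auto simp: mvn_class_block_sum mvn_add_ac\<close>)
  fix z assume "z \<in> carrier ?G"
  then obtain p'' q'' where z: "p'' \<in> all_projections" "q'' \<in> all_projections"
      "z = K0_rel `` {(p'', q'')}"
    by (rule K0_carrier_cases)
  show "x \<otimes>\<^bsub>?G\<^esub> y \<otimes>\<^bsub>?G\<^esub> z = x \<otimes>\<^bsub>?G\<^esub> (y \<otimes>\<^bsub>?G\<^esub> z)"
    unfolding x(3) y(3) z(3)
    using x y z by (simp add: K0_mult all_projections_block_sum block_sum_assoc)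
qed

lemma tracial_state_zero: "tracial_state \<tau> \<Longrightarrow> \<tau> 0 = 0"
  unfolding tracial_state_def by (metis add_cancel_right_right)

lemma tracial_state_sum: "tracial_state \<tau> \<Longrightarrow> \<tau> (\<Sum>i\<in>I. f i) = (\<Sum>i\<in>I. \<tau> (f i))"
  by (induction I rule: infinite_finite_induct) (auto simp: tracial_state_zero, auto simp: tracial_state_def)

lemma tensor_Tr_mult_commute:
  assumes "tracial_state \<tau>" "A \<in> carrier_mat n m" "B \<in> carrier_mat m n"
  shows "tensor_Tr \<tau> (A * B) = tensor_Tr \<tau> (B * A)"
proof -
  have "tensor_Tr \<tau> (A * B) = (\<Sum>i<n. \<Sum>j<m. \<tau> (A $$ (i, j) * B $$ (j, i)))"
    using assms by (auto simp: tensor_Tr_def scalar_prod_def tracial_state_sum atLeast0LessThan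
        intro!: sum.cong)
  also have "\<dots> = (\<Sum>j<m. \<Sum>i<n. \<tau> (B $$ (j, i) * A $$ (i, j)))"
    using assms(1) by (subst sum.swap) (auto simp: tracial_state_def)
  also have "\<dots> = tensor_Tr \<tau> (B * A)"
    using assms by (auto simp: tensor_Tr_def scalar_prod_def tracial_state_sum atLeast0LessThan
        intro!: sum.cong)
  finally show ?thesis .
qed

lemma tensor_Tr_mvn_equiv:
  "tracial_state \<tau> \<Longrightarrow> mvn_equiv p q \<Longrightarrow> tensor_Tr \<tau> p = tensor_Tr \<tau> q"
  unfolding mvn_equiv_def by (metis mat_star_carrier tensor_Tr_mult_commute)

lemma tensor_Tr_block_sum:
  assumes "dim_col p = dim_row p" "dim_col q = dim_row q"
  shows "tensor_Tr \<tau> (p \<oplus>\<^sub>m q) = tensor_Tr \<tau> p + tensor_Tr \<tau> q"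
proof -
  let ?n = "dim_row p" and ?m = "dim_row q"
  have split: "{..<?n + ?m} = {..<?n} \<union> {?n..<?n + ?m}" by auto
  have "tensor_Tr \<tau> (p \<oplus>\<^sub>m q) = (\<Sum>i<?n. \<tau> ((p \<oplus>\<^sub>m q) $$ (i, i))) +
      (\<Sum>i\<in>{?n..<?n + ?m}. \<tau> ((p \<oplus>\<^sub>m q) $$ (i, i)))"
    unfolding tensor_Tr_def block_sum_dim split by (rule sum.union_disjoint) auto
  also have "(\<Sum>i<?n. \<tau> ((p \<oplus>\<^sub>m q) $$ (i, i))) = tensor_Tr \<tau> p"
    using assms by (auto simp: tensor_Tr_def block_sum_def)
  also have "(\<Sum>i\<in>{?n..<?n + ?m}. \<tau> ((p \<oplus>\<^sub>m q) $$ (i, i))) = tensor_Tr \<tau> q"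
    unfolding tensor_Tr_def
    by (rule sum.reindex_bij_witness[of _ "\<lambda>i. i + ?n" "\<lambda>i. i - ?n"])
       (use assms in \<open>auto simp: block_sum_def\<close>)
  finally show ?thesis .
qed

lemma K0_map_rep:
  assumes "tracial_state \<tau>" "p \<in> all_projections" "q \<in> all_projections"
  shows "K0_map \<tau> (K0_rel `` {(p, q)}) = Re (tensor_Tr \<tau> p) - Re (tensor_Tr \<tau> q)"
proof -
  have *: "Re (tensor_Tr \<tau> p') - Re (tensor_Tr \<tau> q') = Re (tensor_Tr \<tau> p) - Re (tensor_Tr \<tau> q)"
    if rel: "((p, q), (p', q')) \<in> K0_rel" for p' q'
  proof -
    from rel obtain r where r: "r \<in> all_projections" "p' \<in> all_projections" "q' \<in> all_projections"
        "mvn_equiv (p \<oplus>\<^sub>m q' \<oplus>\<^sub>m r) (p' \<oplus>\<^sub>m q \<oplus>\<^sub>m r)"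
      by (auto simp: K0_rel_def)
    have "tensor_Tr \<tau> (p \<oplus>\<^sub>m q' \<oplus>\<^sub>m r) = tensor_Tr \<tau> (p' \<oplus>\<^sub>m q \<oplus>\<^sub>m r)"
      using assms r tensor_Tr_mvn_equiv by blast
    then have "tensor_Tr \<tau> p + tensor_Tr \<tau> q' = tensor_Tr \<tau> p' + tensor_Tr \<tau> q"
      using assms r by (simp add: tensor_Tr_block_sum all_projections_iff)
    then have "Re (tensor_Tr \<tau> p + tensor_Tr \<tau> q') = Re (tensor_Tr \<tau> p' + tensor_Tr \<tau> q)"
      by (rule arg_cong)
    then show ?thesis by simp
  qed
  have "(p, q) \<in> K0_rel `` {(p, q)}"
    using assms by (auto simp: K0_rel_iff)
  moreover have "(case x of (p, q) \<Rightarrow> Re (tensor_Tr \<tau> p) - Re (tensor_Tr \<tau> q)) =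
      Re (tensor_Tr \<tau> p) - Re (tensor_Tr \<tau> q)" if "x \<in> K0_rel `` {(p, q)}" for x
    using that *[of "fst x" "snd x"] by (simp add: case_prod_beta)
  ultimately have "(\<lambda>(p, q). Re (tensor_Tr \<tau> p) - Re (tensor_Tr \<tau> q)) ` (K0_rel `` {(p, q)}) =
      {Re (tensor_Tr \<tau> p) - Re (tensor_Tr \<tau> q)}"
    by (metis (no_types, lifting) image_cong image_constant)
  then show ?thesis
    by (simp add: K0_map_def)
qed

lemma nonneg_Reals_sum: "(\<And>i. i \<in> I \<Longrightarrow> f i \<in> \<real>\<^sub>\<ge>\<^sub>0) \<Longrightarrow> (\<Sum>i\<in>I. f i) \<in> \<real>\<^sub>\<ge>\<^sub>0"
  by (induction I rule: infinite_finite_induct) auto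

lemma tensor_Tr_projection_nonneg:
  assumes "tracial_state \<tau>" "p \<in> all_projections"
  shows "tensor_Tr \<tau> p \<in> \<real>\<^sub>\<ge>\<^sub>0"
proof -
  have d: "dim_col p = dim_row p"
    using assms by (simp add: all_projections_iff)
  have "tensor_Tr \<tau> p = tensor_Tr \<tau> (mat_star p * p)"
    using assms by (simp add: all_projections_iff)
  also have "\<dots> = (\<Sum>i<dim_row p. \<Sum>j<dim_row p. \<tau> (star (p $$ (j, i)) * p $$ (j, i)))"
    using assms(1) d by (auto simp: tensor_Tr_def scalar_prod_def tracial_state_sum atLeast0LessThan
        intro!: sum.cong)
  also have "\<dots> \<in> \<real>\<^sub>\<ge>\<^sub>0"
  proof (intro nonneg_Reals_sum)
    show "\<tau> (star x * x) \<in> \<real>\<^sub>\<ge>\<^sub>0" for x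
      using assms(1) unfolding tracial_state_def by blast
  qed
  finally show ?thesis .
qed

lemma K0_map_class:
  assumes "tracial_state \<tau>" "p \<in> all_projections"
  shows "complex_of_real (K0_map \<tau> (K0_class p)) = tensor_Tr \<tau> p"
proof -
  have "complex_of_real (Re (tensor_Tr \<tau> p)) = tensor_Tr \<tau> p"
    using tensor_Tr_projection_nonneg[OF assms] by (auto elim!: nonneg_Reals_cases)
  then show ?thesis
    using assms unfolding K0_class_def by (simp add: K0_map_rep) (simp add: tensor_Tr_def)
qed

lemma K0_map_hom:
  assumes "tracial_state \<tau>"
  shows "K0_map \<tau> \<in> hom K0 \<lparr>carrier = UNIV, monoid.mult = (+), one = 0\<rparr>"
proof (rule homI)
  fix x y :: "('a mat \<times> 'a mat) set"
  assume "x \<in> carrier K0" "y \<in> carrier K0"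
  then obtain p q p' q' where *: "p \<in> all_projections" "q \<in> all_projections"
      "x = K0_rel `` {(p, q)}" "p' \<in> all_projections" "q' \<in> all_projections"
      "y = K0_rel `` {(p', q')}"
    by (metis K0_carrier_cases)
  then show "K0_map \<tau> (x \<otimes>\<^bsub>K0\<^esub> y) =
      K0_map \<tau> x \<otimes>\<^bsub>\<lparr>carrier = UNIV, monoid.mult = (+), one = 0\<rparr>\<^esub> K0_map \<tau> y"
    using assms by (simp add: K0_mult K0_map_rep all_projections_block_sum)
      (simp add: tensor_Tr_block_sum all_projections_iff)
qed simp

section \<open>Inner multiplier groups\<close>

definition inner_multipliers :: "real set \<Rightarrow> real set" where
  "inner_multipliers E = {t. t \<noteq> 0 \<and> t \<in> E \<and> inverse t \<in> E \<and> (\<lambda>x. t * x) ` E = E}"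

definition pos_inner_multipliers :: "real set \<Rightarrow> real set" where
  "pos_inner_multipliers E = inner_multipliers E \<inter> {0<..}"

section \<open>Integral group rings\<close>

text \<open>Finitely supported integer-valued functions on \<open>G\<close> under convolution.\<close>

definition int_group_ring :: "('g, 'm) monoid_scheme \<Rightarrow> ('g \<Rightarrow>\<^sub>0 int) ring" where
  "int_group_ring G =
     \<lparr>carrier = {c. Poly_Mapping.keys c \<subseteq> carrier G},
      monoid.mult = (\<lambda>c d. frag_extend (\<lambda>s. frag_extend (\<lambda>t. frag_of (s \<otimes>\<^bsub>G\<^esub> t)) d) c),
      one = frag_of \<one>\<^bsub>G\<^esub>,
      zero = 0,
      add = (+)\<rparr>"

definition mult_reals :: "real set \<Rightarrow> real monoid" where
  "mult_reals F = \<lparr>carrier = F, monoid.mult = (*), one = 1\<rparr>"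

text \<open>
  The additive group \<open>E\<close> of reals with \<open>\<Sum> n\<^sub>t t\<close> acting as multiplication by that real number. The
  locale \<open>module\<close> does not use the multiplicative structure of the module record.
\<close>

definition real_module :: "real set \<Rightarrow> (real \<Rightarrow>\<^sub>0 int, real) module" where
  "real_module E =
     \<lparr>carrier = E, monoid.mult = undefined, one = undefined, zero = 0, add = (+),
      smult = (\<lambda>c x. (\<Sum>t\<in>Poly_Mapping.keys c. of_int (Poly_Mapping.lookup c t) * t) * x)\<rparr>"

end

theory Submission
  imports
    Defs
    "HOL-Computational_Algebra.Formal_Power_Series"
    "HOL-Analysis.Elementary_Metric_Spaces"
begin

text \<open>
  An element \<open>t\<close> of the fundamental group comes from an isomorphism \<open>\<psi>\<close> of \<open>A\<close> onto a corner \<open>p M\<^sub>n(A) p\<close>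
  with \<open>(\<tau> \<otimes> Tr) p = t\<close>. The normalized trace of the corner pulls back to a tracial state of \<open>A\<close>, so by
  uniqueness \<open>(\<tau> \<otimes> Tr) (\<psi> a) = t \<tau> a\<close>, and applying \<open>\<psi>\<close> entrywise to a projection over \<open>A\<close> multiplies
  its trace by \<open>t\<close>. Composing two such isomorphisms entrywise shows that the fundamental group is
  closed under products.

  For inverses, simplicity gives \<open>\<Sum> a\<^sub>i b\<^sub>i = 1\<close> with columns \<open>b\<close> in the range of \<open>p\<close>, hence
  \<open>\<Sum> b\<^sub>i\<^sup>* b\<^sub>i \<ge> \<delta> > 0\<close>, and rescaling by the inverse square root yields an isometric column \<open>W\<close> with
  \<open>(p \<otimes> 1) W = W\<close>. Then \<open>a \<mapsto> \<psi>\<^sup>-\<^sup>1 (W a W\<^sup>*)\<close> is an isomorphism of \<open>A\<close> onto a corner whose unit has trace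
  \<open>1 / t\<close>. The only C*-theory needed is the positivity of \<open>x\<^sup>* x\<close>, for which the binomial series of the
  square root suffices.
\<close>

section \<open>Square roots and positivity in unital C*-algebras\<close>

lemma star_minus: "star (- x) = - star (x::'a::unital_cstar_algebra)"
  using star_add[of x "- x"] by (simp add: eq_neg_iff_add_eq_0 add.commute)

lemma star_diff: "star (x - y) = star x - star (y::'a::unital_cstar_algebra)"
  using star_add[of x "- y"] by (simp add: star_minus)

lemma star_scaleR: "star (r *\<^sub>R x) = r *\<^sub>R star (x::'a::unital_cstar_algebra)"
  using star_scaleC[of "complex_of_real r" x] by (simp add: scaleC_of_real)

lemma star_one [simp]: "star 1 = (1::'a::unital_cstar_algebra)"
  by (metis mult_1 mult_1_right star_mult star_star)

lemma star_power: "star (x ^ n) = star (x::'a::unital_cstar_algebra) ^ n"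
  by (induction n) (auto simp: star_mult power_commutes)

text \<open>The C*-identity and submultiplicativity bound \<open>norm y\<close> by
  \<open>norm (star y)\<close>; the involution makes the bound symmetric.\<close>

lemma norm_star [simp]: "norm (star x) = norm (x::'a::unital_cstar_algebra)"
proof -
  have "norm y \<le> norm (star y)" for y :: 'a
  proof (cases "y = 0")
    case False
    have "norm y * norm y \<le> norm (star y) * norm y"
      using cstar_identity[of y] norm_mult_ineq[of "star y" y] by (simp add: power2_eq_square)
    then show ?thesis using False by simp
  qed simp
  from this[of x] this[of "star x"] show ?thesis by (simp add: star_star)
qed

lemma bounded_linear_star: "bounded_linear (star :: 'a::unital_cstar_algebra \<Rightarrow> 'a)"
  by (rule bounded_linear_intro[where K=1]) (auto simp: star_add star_scaleR)

lemma star_mult_self_eq_0_iff: "star x * x = 0 \<longleftrightarrow> x = (0::'a::unital_cstar_algebra)"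
  using cstar_identity[of x] by auto

lemma norm_self_adjoint_square:
  "star h = h \<Longrightarrow> norm (h * h) = (norm (h::'a::unital_cstar_algebra))\<^sup>2"
  using cstar_identity[of h] by simp

lemma self_adjoint_square_eq_0: "star h = h \<Longrightarrow> h * h = 0 \<Longrightarrow> h = (0::'a::unital_cstar_algebra)"
  using norm_self_adjoint_square[of h] by simp

text \<open>Neumann series: splitting off the head of the geometric series gives
  \<open>z = 1 + y * z\<close> and, from the other side, \<open>z = 1 + z * y\<close>.\<close>

lemma inverse_one_minus:
  fixes y :: "'a::{real_normed_algebra_1,banach}"
  assumes "norm y < 1"
  obtains z where "z * (1 - y) = 1" "(1 - y) * z = 1"
proof -
  define z where "z = suminf (\<lambda>n. y ^ n)"
  have s: "summable (\<lambda>n. y ^ n)"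
    by (rule complete_algebra_summable_geometric[OF assms])
  have "z = 1 + suminf (\<lambda>n. y ^ Suc n)"
    using suminf_split_head[OF s] by (simp add: z_def)
  moreover have "suminf (\<lambda>n. y ^ Suc n) = y * z"
    using suminf_mult[OF s, of y] by (simp add: z_def)
  moreover have "suminf (\<lambda>n. y ^ Suc n) = z * y"
    using suminf_mult2[OF s, of y] by (simp add: z_def power_commutes)
  ultimately have "z = 1 + y * z" "z = 1 + z * y" by auto
  then show ?thesis
    by (intro that[of z]) (simp_all add: algebra_simps)
qed

section \<open>Coefficients of the binomial series of \<open>sqrt (1 - y)\<close>\<close>

definition sqrt_coeff :: "nat \<Rightarrow> real" where
  "sqrt_coeff n = (-1) ^ n * (1/2 gchoose n)"

lemma sqrt_coeff_0 [simp]: "sqrt_coeff 0 = 1"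
  by (simp add: sqrt_coeff_def)

text \<open>These are the binomial coefficients of \<open>1 - y\<close> to the power
  \<open>-1/2\<close>; each arises from its predecessor by the positive factor
  \<open>(n + 1/2) / (n + 1)\<close>. They reappear as the partial sums of
  \<open>sqrt_coeff\<close>.\<close>

lemma minus_half_gchoose_nonneg: "(-1) ^ n * (- 1/2 gchoose n) \<ge> (0::real)"
proof (induction n)
  case (Suc n)
  have "(-1) ^ Suc n * (- 1/2 gchoose Suc n :: real) =
      ((-1) ^ n * (- 1/2 gchoose n)) * ((1/2 + real n) / (real n + 1))"
    by (simp add: gbinomial_prod_rev field_simps)
  also have "\<dots> \<ge> 0"
    by (rule mult_nonneg_nonneg[OF Suc]) auto
  finally show ?case .
qed simp

lemma sqrt_coeff_Suc_nonpos: "sqrt_coeff (Suc n) \<le> 0"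
proof (induction n)
  case 0
  show ?case by (simp add: sqrt_coeff_def)
next
  case (Suc n)
  have "sqrt_coeff (Suc (Suc n)) = sqrt_coeff (Suc n) * ((real n + 1/2) / (real n + 2))"
    by (simp add: sqrt_coeff_def gbinomial_prod_rev field_simps)
  also have "\<dots> \<le> 0"
    using Suc by (intro mult_nonpos_nonneg) auto
  finally show ?case .
qed

text \<open>Dividing the series of \<open>sqrt (1 - y)\<close> by \<open>1 - y\<close> replaces its
  coefficients by their partial sums and yields the series with exponent
  \<open>-1/2\<close>.\<close>

lemma sum_sqrt_coeff: "(\<Sum>k\<le>n. sqrt_coeff k) = (-1) ^ n * (- 1/2 gchoose n)"
  using gbinomial_sum_lower_neg[of "1/2 :: real" n] by (simp add: sqrt_coeff_def mult.commute)

text \<open>All coefficients after the first are nonpositive, so their absolute values add up to 1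
  minus a partial sum, and partial sums are nonnegative. The bound is uniform in \<open>n\<close>,
  which gives absolute convergence on the closed unit ball.\<close>

lemma sum_abs_sqrt_coeff_Suc: "(\<Sum>k<n. \<bar>sqrt_coeff (Suc k)\<bar>) \<le> 1"
proof -
  have "(\<Sum>k<n. \<bar>sqrt_coeff (Suc k)\<bar>) = 1 - (\<Sum>k\<le>n. sqrt_coeff k)"
    using sqrt_coeff_Suc_nonpos
    by (simp add: sum.atMost_shift abs_of_nonpos sum_negf)
  then show ?thesis
    using minus_half_gchoose_nonneg[of n] by (simp add: sum_sqrt_coeff)
qed

lemma summable_abs_sqrt_coeff_Suc: "summable (\<lambda>k. \<bar>sqrt_coeff (Suc k)\<bar>)"
  by (rule summableI_nonneg_bounded[OF _ sum_abs_sqrt_coeff_Suc]) simp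

lemma suminf_abs_sqrt_coeff_Suc: "suminf (\<lambda>k. \<bar>sqrt_coeff (Suc k)\<bar>) \<le> 1"
  by (rule suminf_le_const[OF summable_abs_sqrt_coeff_Suc sum_abs_sqrt_coeff_Suc])

text \<open>Vandermonde's identity, that is, comparison of coefficients when
  \<open>sqrt (1 - y)\<close> is squared.\<close>

lemma sqrt_coeff_convolution:
  "(\<Sum>k\<le>n. sqrt_coeff k * sqrt_coeff (n - k)) = (-1) ^ n * (1 gchoose n)"
proof -
  have "(\<Sum>k\<le>n. sqrt_coeff k * sqrt_coeff (n - k)) =
      (\<Sum>k\<le>n. (-1) ^ n * ((1/2 gchoose k) * (1/2 gchoose (n - k))))"
    by (intro sum.cong refl) (auto simp: sqrt_coeff_def simp flip: power_add)
  also have "\<dots> = (-1) ^ n * (1 gchoose n)"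
    using gbinomial_Vandermonde[of "1/2::real" "1/2" n]
    by (simp add: atMost_atLeast0 flip: sum_distrib_left)
  finally show ?thesis .
qed

text \<open>The binomial series of \<open>sqrt (1 - y)\<close> converges absolutely up to the boundary \<open>norm y = 1\<close>.\<close>

lemma sqrt_one_minus:
  fixes y :: "'a::unital_cstar_algebra"
  assumes "star y = y" "norm y \<le> 1"
  obtains r where "star r = r" "r * r = 1 - y" "norm (1 - r) \<le> 1"
    "\<And>z. z * y = y * z \<Longrightarrow> z * r = r * z"
proof -
  define f where "f n = sqrt_coeff n *\<^sub>R y ^ n" for n
  define r where "r = suminf (\<lambda>n. f n)"
  have pow: "norm (y ^ n) \<le> 1" for n
    using norm_power_ineq[of y n] power_le_one[OF norm_ge_zero assms(2), of n] by linarith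
  then have bound: "norm (f n) \<le> \<bar>sqrt_coeff n\<bar>" for n
    using mult_left_mono[OF pow[of n], of "\<bar>sqrt_coeff n\<bar>"] by (simp add: f_def)
  have sn: "summable (\<lambda>n. norm (f n))"
    using summable_abs_sqrt_coeff_Suc bound
    by (subst summable_Suc_iff[symmetric]) (rule summable_comparison_test', auto)
  then have s: "summable f" by (rule summable_norm_cancel)
  have "star r = suminf (\<lambda>n. star (f n))"
    unfolding r_def using bounded_linear.suminf[OF bounded_linear_star s] by simp
  then have 1: "star r = r"
    by (simp add: r_def f_def star_scaleR star_power assms)
  have "r * r = suminf (\<lambda>n. \<Sum>i\<le>n. f i * f (n - i))"
    unfolding r_def by (rule Cauchy_product[OF sn sn])
  also have "\<dots> = suminf (\<lambda>n. ((-1) ^ n * (1 gchoose n)) *\<^sub>R y ^ n)"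
  proof (rule suminf_cong)
    fix n
    have "(\<Sum>i\<le>n. f i * f (n - i)) = (\<Sum>i\<le>n. (sqrt_coeff i * sqrt_coeff (n - i)) *\<^sub>R y ^ n)"
      by (intro sum.cong) (auto simp: f_def simp flip: power_add)
    then show "(\<Sum>i\<le>n. f i * f (n - i)) = ((-1) ^ n * (1 gchoose n)) *\<^sub>R y ^ n"
      by (simp add: sqrt_coeff_convolution flip: scaleR_sum_left)
  qed
  \<comment> \<open>\<open>1 gchoose n\<close> vanishes for \<open>n \<ge> 2\<close>, so only the
    terms \<open>1\<close> and \<open>- y\<close> survive.\<close>
  also have "\<dots> = (\<Sum>n\<in>{0,1}. ((-1) ^ n * (1 gchoose n)) *\<^sub>R y ^ n)"
  proof (rule suminf_finite)
    fix n :: nat assume "n \<notin> {0, 1}"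
    then have "(1::nat) choose n = 0" by (intro binomial_eq_0) auto
    then have "(1::real) gchoose n = 0"
      using binomial_gbinomial[of 1 n, where 'a=real] by (metis of_nat_0 of_nat_1)
    then show "((-1) ^ n * (1 gchoose n)) *\<^sub>R y ^ n = 0" by simp
  qed simp
  also have "\<dots> = 1 - y" by simp
  finally have 2: "r * r = 1 - y" .
  \<comment> \<open>The head of the series is 1, so \<open>1 - r\<close> is minus the tail, whose
    coefficients sum to at most 1 in absolute value.\<close>
  have "r = f 0 + suminf (\<lambda>n. f (Suc n))"
    using suminf_split_head[OF s] by (simp add: r_def)
  then have "norm (1 - r) = norm (suminf (\<lambda>n. f (Suc n)))"
    by (simp add: f_def)
  also have "\<dots> \<le> suminf (\<lambda>n. norm (f (Suc n)))"
    using sn by (intro summable_norm) (subst summable_Suc_iff)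
  also have "\<dots> \<le> suminf (\<lambda>n. \<bar>sqrt_coeff (Suc n)\<bar>)"
    using bound sn summable_abs_sqrt_coeff_Suc by (intro suminf_le) (auto simp: summable_Suc_iff[of "\<lambda>n. norm (f n)"])
  also have "\<dots> \<le> 1" by (rule suminf_abs_sqrt_coeff_Suc)
  finally have 3: "norm (1 - r) \<le> 1" .
  have 4: "z * r = r * z" if "z * y = y * z" for z
  proof -
    have "z * y ^ n = y ^ n * z" for n
      using power_commuting_commutes[OF that[symmetric], of n] by simp
    then have "z * f n = f n * z" for n
      by (simp add: f_def)
    then show ?thesis
      using suminf_mult[OF s, of z] suminf_mult2[OF s, of z] by (simp add: r_def)
  qed
  show ?thesis by (rule that[OF 1 2 3 4])
qed

text \<open>For self-adjoint \<open>a\<close> the norm condition says that the spectrum of \<open>a\<close> lies in \<open>[0, 2s]\<close>.\<close>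

definition cstar_pos :: "'a::unital_cstar_algebra \<Rightarrow> bool" where
  "cstar_pos a \<longleftrightarrow> star a = a \<and> (\<exists>s. norm (s *\<^sub>R 1 - a) \<le> s)"

section \<open>The cone of positive elements and their square roots\<close>

lemma cstar_pos_add: "cstar_pos a \<Longrightarrow> cstar_pos b \<Longrightarrow> cstar_pos (a + b)"
proof -
  assume "cstar_pos a" "cstar_pos b"
  then obtain s t where *: "star a = a" "star b = b" "norm (s *\<^sub>R 1 - a) \<le> s" "norm (t *\<^sub>R 1 - b) \<le> t"
    by (auto simp: cstar_pos_def)
  have "(s + t) *\<^sub>R 1 - (a + b) = (s *\<^sub>R 1 - a) + (t *\<^sub>R 1 - b)"
    by (simp add: algebra_simps)
  then have "norm ((s + t) *\<^sub>R 1 - (a + b)) \<le> s + t"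
    using * norm_triangle_le by (metis add_mono)
  then show ?thesis
    using * unfolding cstar_pos_def by (metis star_add)
qed

lemma cstar_pos_0 [simp]: "cstar_pos 0"
  by (auto simp: cstar_pos_def intro: exI[of _ 0])

lemma cstar_pos_sum: "(\<And>i. i \<in> I \<Longrightarrow> cstar_pos (f i)) \<Longrightarrow> cstar_pos (\<Sum>i\<in>I. f i)"
  by (induction I rule: infinite_finite_induct) (auto intro: cstar_pos_add)

lemma cstar_pos_scaleR: "cstar_pos a \<Longrightarrow> r \<ge> 0 \<Longrightarrow> cstar_pos (r *\<^sub>R a)"
proof -
  assume "cstar_pos a" and r: "r \<ge> 0"
  then obtain s where *: "star a = a" "norm (s *\<^sub>R 1 - a) \<le> s"
    by (auto simp: cstar_pos_def)
  have "norm ((r * s) *\<^sub>R 1 - r *\<^sub>R a) = r * norm (s *\<^sub>R 1 - a)"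
    using r by (simp flip: scaleR_scaleR scaleR_diff_right)
  also have "\<dots> \<le> r * s" using r * by (simp add: mult_left_mono)
  finally show ?thesis
    using * by (auto simp: cstar_pos_def star_scaleR)
qed

text \<open>If \<open>s > 0\<close> witnesses positivity of \<open>a\<close>, then
  \<open>y = 1 - a / s\<close> lies in the closed unit ball, and the root \<open>r\<close> of
  \<open>1 - y\<close> is rescaled by \<open>sqrt s\<close>. Positivity of \<open>r\<close> is the
  bound \<open>norm (1 - r) \<le> 1\<close>; the commutation clause supplies commuting roots to
  later arguments.\<close>

lemma cstar_pos_sqrt:
  assumes "cstar_pos a"
  obtains h where "star h = h" "h * h = a" "cstar_pos h" "\<And>z. z * a = a * z \<Longrightarrow> z * h = h * z"
proof -
  from assms obtain s where *: "star a = a" "norm (s *\<^sub>R 1 - a) \<le> s"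
    by (auto simp: cstar_pos_def)
  then have "s \<ge> 0" using norm_ge_zero order_trans by blast
  show ?thesis
  proof (cases "s = 0")
    case True
    then have "a = 0" using * by simp
    then show ?thesis by (intro that[of 0]) auto
  next
    case False
    with \<open>s \<ge> 0\<close> have s: "s > 0" by simp
    define y where "y = 1 - (1/s) *\<^sub>R a"
    have "y = (1/s) *\<^sub>R (s *\<^sub>R 1 - a)"
      using s by (simp add: y_def algebra_simps)
    then have ny: "norm y \<le> 1" using s * by simp
    have sy: "star y = y" using * by (simp add: y_def star_diff star_scaleR)
    obtain r where r: "star r = r" "r * r = 1 - y" "norm (1 - r) \<le> 1"
      "\<And>z. z * y = y * z \<Longrightarrow> z * r = r * z"
      by (rule sqrt_one_minus[OF sy ny]) blast
    have pr: "cstar_pos r"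
      using r(1,3) by (auto simp: cstar_pos_def intro: exI[of _ 1])
    show ?thesis
    proof (rule that[of "sqrt s *\<^sub>R r"])
      show "star (sqrt s *\<^sub>R r) = sqrt s *\<^sub>R r"
        by (simp add: star_scaleR r(1))
      show "sqrt s *\<^sub>R r * sqrt s *\<^sub>R r = a"
        using s by (simp add: r(2) y_def)
      show "cstar_pos (sqrt s *\<^sub>R r)"
        using pr s by (intro cstar_pos_scaleR) auto
      fix z assume "z * a = a * z"
      then have "z * y = y * z" by (simp add: y_def algebra_simps)
      from r(4)[OF this] show "z * sqrt s *\<^sub>R r = sqrt s *\<^sub>R r * z" by simp
    qed
  qed
qed

section \<open>Complex scalars and positivity of \<open>star x * x\<close>\<close>

lemma scaleC_zero [simp]: "c *\<^sub>C (0::'a::unital_cstar_algebra) = 0"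
  using norm_scaleC[of c "0::'a"] by simp

lemma scaleC_minus_right: "c *\<^sub>C (- x) = - (c *\<^sub>C (x::'a::unital_cstar_algebra))"
  using scaleC_add_right[of c x "- x"] by (simp add: eq_neg_iff_add_eq_0 add.commute)

lemma scaleC_diff_right: "c *\<^sub>C (x - y) = c *\<^sub>C x - c *\<^sub>C (y::'a::unital_cstar_algebra)"
  using scaleC_add_right[of c x "- y"] by (simp add: scaleC_minus_right)

lemma scaleC_minus_one: "(- 1) *\<^sub>C x = - (x::'a::unital_cstar_algebra)"
  using scaleC_of_real[of "-1" x] by simp

lemma scaleC_minus_ii: "(- \<i>) *\<^sub>C x = - (\<i> *\<^sub>C (x::'a::unital_cstar_algebra))"
  by (metis mult_minus1_right scaleC_minus_one scaleC_minus_right scaleC_scaleC)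

text \<open>Commutation cancels the cross terms \<open>\<i> (h k - k h)\<close>.\<close>

lemma commuting_self_adjoint_cartesian:
  fixes h k :: "'a::unital_cstar_algebra"
  assumes "star h = h" "star k = k" "h * k = k * h"
  shows "star (h + \<i> *\<^sub>C k) * (h + \<i> *\<^sub>C k) = h * h + k * k"
  using assms
  by (simp add: star_add star_scaleC algebra_simps mult_scaleC_left mult_scaleC_right
      scaleC_scaleC scaleC_diff_right scaleC_minus_ii scaleC_minus_one)

text \<open>If \<open>norm h \<le> 1\<close>, then \<open>h + i k\<close> with \<open>k = sqrt (1 - h\<^sup>2)\<close> is an isometry, so
  \<open>norm (1 - h\<^sup>2) = (norm k)\<^sup>2 \<le> 1\<close>.\<close>

lemma norm_one_minus_square_le:
  fixes h :: "'a::unital_cstar_algebra"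
  assumes "star h = h" "norm h \<le> 1"
  shows "norm (1 - h * h) \<le> 1"
proof -
  have "norm (h * h) \<le> 1"
    using assms by (simp add: norm_self_adjoint_square power_le_one)
  moreover have "star (h * h) = h * h" by (simp add: star_mult assms)
  ultimately obtain k where k: "star k = k" "k * k = 1 - h * h"
    "\<And>z. z * (h * h) = h * h * z \<Longrightarrow> z * k = k * z"
    by (metis sqrt_one_minus)
  define u where "u = h + \<i> *\<^sub>C k"
  have hk: "h * k = k * h" by (rule k(3)) (simp add: mult.assoc)
  have "star u * u = 1"
    unfolding u_def using assms k(1,2) hk by (subst commuting_self_adjoint_cartesian) auto
  then have u: "norm u = 1"
    using cstar_identity[of u] power2_eq_iff_nonneg[of "norm u" 1] by simp
  have "u - star u = (2 * \<i>) *\<^sub>C k"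
    using assms k(1) by (simp add: u_def star_add star_scaleC scaleC_minus_ii flip: scaleC_add_left)
  then have "2 * norm k = norm (u - star u)"
    by (simp add: norm_scaleC norm_mult)
  also have "\<dots> \<le> 2"
    using norm_triangle_ineq4[of u "star u"] u by simp
  finally have "norm k \<le> 1" by simp
  then show ?thesis
    using norm_self_adjoint_square[OF k(1)] k(2) by (simp add: power_le_one)
qed

text \<open>For \<open>h\<close> scaled to norm 1, \<open>norm_one_minus_square_le\<close> says that
  \<open>s = 1\<close> witnesses positivity of the square.\<close>

lemma cstar_pos_square:
  fixes h :: "'a::unital_cstar_algebra"
  assumes "star h = h"
  shows "cstar_pos (h * h)"
proof (cases "h = 0")
  case False
  define g where "g = (1 / norm h) *\<^sub>R h"
  have g: "star g = g" "norm g \<le> 1"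
    using assms False by (auto simp: g_def star_scaleR)
  then have "cstar_pos (g * g)"
    using norm_one_minus_square_le[of g] by (auto simp: cstar_pos_def star_mult intro: exI[of _ 1])
  then have "cstar_pos ((norm h)\<^sup>2 *\<^sub>R (g * g))"
    by (rule cstar_pos_scaleR) simp
  then show ?thesis
    using False by (simp add: g_def power2_eq_square)
qed simp

text \<open>With commuting roots \<open>h\<close> of \<open>a\<close> and \<open>g\<close> of
  \<open>- a\<close>, the element \<open>z = h + \<i> g\<close> satisfies
  \<open>star z * z = a - a = 0\<close>. So \<open>z\<close> vanishes, and with it its real part
  \<open>h\<close>.\<close>

lemma cstar_pos_antisym:
  fixes a :: "'a::unital_cstar_algebra"
  assumes "cstar_pos a" "cstar_pos (- a)"
  shows "a = 0"
proof -
  obtain h where h: "star h = h" "h * h = a" "\<And>z. z * a = a * z \<Longrightarrow> z * h = h * z"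
    using cstar_pos_sqrt[OF assms(1)] by metis
  obtain g where g: "star g = g" "g * g = - a" "\<And>z. z * (- a) = (- a) * z \<Longrightarrow> z * g = g * z"
    using cstar_pos_sqrt[OF assms(2)] by metis
  have "h * a = a * h" using h(2) by (metis mult.assoc)
  then have hg: "h * g = g * h" by (intro g(3)) simp
  define z where "z = h + \<i> *\<^sub>C g"
  have "star z * z = 0"
    unfolding z_def using h(1,2) g(1,2) hg by (subst commuting_self_adjoint_cartesian) auto
  then have "z = 0" by (simp add: star_mult_self_eq_0_iff)
  then have "z + star z = 0" by simp
  moreover have "z + star z = 2 *\<^sub>R h"
    using h(1) g(1) by (simp add: z_def star_add star_scaleC scaleC_minus_ii scaleR_2)
  ultimately have "h = 0" by simp
  then show ?thesis using h(2) by simp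
qed

text \<open>The squares of the self-adjoint elements \<open>x + star x\<close> and
  \<open>\<i> (x - star x)\<close> add up to twice the given element.\<close>

lemma cstar_pos_commutator_sum:
  fixes x :: "'a::unital_cstar_algebra"
  shows "cstar_pos (star x * x + x * star x)"
proof -
  define p q where "p = x + star x" and "q = \<i> *\<^sub>C (x - star x)"
  have "star p = p" by (simp add: p_def star_add star_star add.commute)
  moreover have "star q = q"
    by (simp add: q_def star_diff star_star star_scaleC scaleC_minus_ii flip: scaleC_minus_right)
  ultimately have "cstar_pos (p * p + q * q)"
    by (intro cstar_pos_add cstar_pos_square)
  also have "q * q = - ((x - star x) * (x - star x))"
    by (simp add: q_def mult_scaleC_left mult_scaleC_right scaleC_scaleC scaleC_minus_one)
  then have "p * p + q * q = 2 *\<^sub>R (star x * x + x * star x)"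
    by (simp add: p_def algebra_simps scaleR_2)
  finally show ?thesis
    using cstar_pos_scaleR[of "2 *\<^sub>R (star x * x + x * star x)" "1/2"] by simp
qed

text \<open>With \<open>x\<^sup>* x = - k\<^sup>2\<close> and \<open>x x\<^sup>* = l\<^sup>2\<close>, the element \<open>y = k x\<^sup>*\<close> satisfies
  \<open>y\<^sup>* y + y y\<^sup>* = - (k\<^sup>4 + l\<^sup>4)\<close>, which is both positive and negative.\<close>

lemma cstar_pos_minus_star_mult_self:
  fixes x :: "'a::unital_cstar_algebra"
  assumes "cstar_pos (- (star x * x))"
  shows "x = 0"
proof -
  obtain k where k: "star k = k" "k * k = - (star x * x)"
    using cstar_pos_sqrt[OF assms] by metis
  \<comment> \<open>By the choice of \<open>k\<close>, adding \<open>k * k\<close> cancels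
    \<open>star x * x\<close>, which leaves \<open>x * star x\<close> positive.\<close>
  have "cstar_pos (star x * x + x * star x + k * k)"
    by (intro cstar_pos_add cstar_pos_commutator_sum cstar_pos_square k)
  then have "cstar_pos (x * star x)" by (simp add: k)
  then obtain l where l: "star l = l" "l * l = x * star x"
    using cstar_pos_sqrt by metis
  define y where "y = k * star x"
  have sy: "star y = x * k" by (simp add: y_def star_mult star_star k)
  have "star y * y = x * (k * k) * star x" unfolding sy unfolding y_def by (simp add: mult.assoc)
  also have "\<dots> = - (l * l * (l * l))" by (simp add: k l mult.assoc)
  finally have 1: "star y * y = - (l * l * (l * l))" .
  have "y * star y = k * (star x * x) * k" unfolding sy unfolding y_def by (simp add: mult.assoc)
  also have "star x * x = - (k * k)" using k by simp
  also have "k * - (k * k) * k = - (k * k * (k * k))" by (simp add: mult.assoc)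
  finally have 2: "y * star y = - (k * k * (k * k))" .
  have pk: "cstar_pos (k * k * (k * k))" and pl: "cstar_pos (l * l * (l * l))"
    by (intro cstar_pos_square; simp add: star_mult k(1) l(1))+
  have "cstar_pos (- (l * l * (l * l) + k * k * (k * k)))"
    using cstar_pos_commutator_sum[of y] 1 2 by simp
  then have "cstar_pos (- (l * l * (l * l) + k * k * (k * k)) + l * l * (l * l))"
    using pl by (rule cstar_pos_add)
  then have "cstar_pos (- (k * k * (k * k)))" by simp
  then have "k * k * (k * k) = 0" using pk cstar_pos_antisym by blast
  then have "k * k = 0" by (intro self_adjoint_square_eq_0[of "k * k"]) (simp_all add: star_mult k(1))
  then show ?thesis using k(2) by (simp add: star_mult_self_eq_0_iff)
qed

text \<open>For \<open>h = x\<^sup>* x\<close> and \<open>g = \<bar>h\<bar> - h\<close>, twice the negative part of \<open>h\<close>, the element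
  \<open>z = x \<bar>h\<bar>\<^bsup>1/2\<^esup> g\<close> has \<open>z\<^sup>* z = - g\<^sup>4 / 4\<close>.\<close>

theorem cstar_pos_star_mult_self:
  fixes x :: "'a::unital_cstar_algebra"
  shows "cstar_pos (star x * x)"
proof -
  define h where "h = star x * x"
  have sh: "star h = h" by (simp add: h_def star_mult star_star)
  obtain a where a: "star a = a" "a * a = h * h" "cstar_pos a"
    "\<And>z. z * (h * h) = h * h * z \<Longrightarrow> z * a = a * z"
    using cstar_pos_sqrt[OF cstar_pos_square[OF sh]] by metis
  have ha: "h * a = a * h" by (rule a(4)) (simp add: mult.assoc)
  obtain m where m: "star m = m" "m * m = a" "\<And>z. z * a = a * z \<Longrightarrow> z * m = m * z"
    using cstar_pos_sqrt[OF a(3)] by metis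
  have hm: "h * m = m * h" by (rule m(3)[OF ha])
  define g where "g = a - h"
  have sg: "star g = g" by (simp add: g_def star_diff a(1) sh)
  have gm: "g * m = m * g" by (simp add: g_def algebra_simps hm) (simp add: mult.assoc flip: m(2))
  \<comment> \<open>As \<open>a\<close> commutes with \<open>h\<close> and has the same square,
    \<open>h * g\<close> and \<open>a * g\<close> are both multiples of \<open>g * g\<close>, with
    opposite signs.\<close>
  have "g * g = (h * h - h * a) + (h * h - h * a)"
    by (simp add: g_def algebra_simps a(2) ha)
  then have g2: "g * g = 2 *\<^sub>R (h * h - h * a)" by (simp only: scaleR_2)
  have hg: "h * g = - ((1/2) *\<^sub>R (g * g))"
    unfolding g2 by (simp add: g_def right_diff_distrib)
  have ag: "a * g = (1/2) *\<^sub>R (g * g)"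
    unfolding g2 by (simp add: g_def right_diff_distrib a(2) ha)
  have "g * h = h * g" by (simp add: g_def algebra_simps ha)
  then have gh: "g * (h * y) = h * (g * y)" for y by (metis mult.assoc)
  have mh: "m * (h * y) = h * (m * y)" for y by (metis hm mult.assoc)
  define z where "z = x * (m * g)"
  have "star z * z = g * (m * (h * (m * g)))"
    by (simp add: z_def star_mult m(1) sg h_def mult.assoc)
  also have "\<dots> = g * (h * (m * m) * g)"
    by (simp add: mh mult.assoc)
  also have "\<dots> = (h * g) * (a * g)"
    by (simp add: m(2) gh mult.assoc)
  also have "\<dots> = - (((1/2) *\<^sub>R (g * g)) * ((1/2) *\<^sub>R (g * g)))"
    unfolding hg ag by simp
  finally have zz: "- (star z * z) = ((1/2) *\<^sub>R (g * g)) * ((1/2) *\<^sub>R (g * g))" by simp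
  have "cstar_pos (- (star z * z))"
    unfolding zz by (rule cstar_pos_square) (simp add: star_mult star_scaleR sg)
  then have "z = 0" by (rule cstar_pos_minus_star_mult_self)
  then have "(g * g) * (g * g) = 0" using zz by simp
  then have "g * g = 0" by (intro self_adjoint_square_eq_0[of "g * g"]) (simp_all add: star_mult sg)
  then have "g = 0" by (rule self_adjoint_square_eq_0[OF sg])
  \<comment> \<open>Vanishing of \<open>g\<close> means \<open>h = a\<close>, and \<open>a\<close>
    was chosen as a positive root.\<close>
  then show ?thesis using a(3) by (simp add: g_def h_def)
qed

text \<open>Expanding \<open>\<Sum> (a\<^sub>i\<^sup>* / K - b\<^sub>i)\<^sup>* (a\<^sub>i\<^sup>* / K - b\<^sub>i) \<ge> 0\<close> with \<open>K \<ge> \<Sum> a\<^sub>i a\<^sub>i\<^sup>*\<close> gives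
  \<open>\<Sum> b\<^sub>i\<^sup>* b\<^sub>i \<ge> 1 / K\<close>.\<close>

lemma ex_normalized_column:
  fixes a b :: "'i \<Rightarrow> 'a::unital_cstar_algebra"
  assumes ab: "(\<Sum>i\<in>I. a i * b i) = 1"
  obtains s where "(\<Sum>i\<in>I. star (b i * s) * (b i * s)) = 1"
proof -
  define c where "c = (\<Sum>i\<in>I. star (b i) * b i)"
  define d where "d = (\<Sum>i\<in>I. a i * star (a i))"
  define K where "K = norm d + 1"
  have K: "K > 0" using norm_ge_zero[of d] by (simp only: K_def)
  have sd: "star d = d" by (simp add: d_def star_sum star_mult star_star)
  have sc: "star c = c" by (simp add: c_def star_sum star_mult star_star)
  \<comment> \<open>The witness is \<open>s = K\<close>, since \<open>K - (K - d) = d\<close> has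
    norm below \<open>K\<close>.\<close>
  have "cstar_pos (K *\<^sub>R 1 - d)"
    using sd by (auto simp: cstar_pos_def K_def star_diff star_scaleR intro!: exI[of _ K])
  then have "cstar_pos ((1/K^2) *\<^sub>R (K *\<^sub>R 1 - d))"
    by (rule cstar_pos_scaleR) simp
  moreover have "cstar_pos (\<Sum>i\<in>I. star ((1/K) *\<^sub>R star (a i) - b i) * ((1/K) *\<^sub>R star (a i) - b i))"
    by (intro cstar_pos_sum cstar_pos_star_mult_self)
  moreover have "(\<Sum>i\<in>I. star ((1/K) *\<^sub>R star (a i) - b i) * ((1/K) *\<^sub>R star (a i) - b i)) =
      (1/K^2) *\<^sub>R d - (1/K) *\<^sub>R 1 - (1/K) *\<^sub>R 1 + c"
  proof -
    have "star ((1/K) *\<^sub>R star (a i) - b i) * ((1/K) *\<^sub>R star (a i) - b i) =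
        (1/K^2) *\<^sub>R (a i * star (a i)) - (1/K) *\<^sub>R (a i * b i) - (1/K) *\<^sub>R star (a i * b i)
        + star (b i) * b i" for i
      by (simp add: star_diff star_scaleR star_star star_mult algebra_simps power2_eq_square)
    then have "(\<Sum>i\<in>I. star ((1/K) *\<^sub>R star (a i) - b i) * ((1/K) *\<^sub>R star (a i) - b i)) =
      (1/K^2) *\<^sub>R d - (1/K) *\<^sub>R (\<Sum>i\<in>I. a i * b i) - (1/K) *\<^sub>R star (\<Sum>i\<in>I. a i * b i) + c"
      by (simp add: sum.distrib sum_subtractf star_sum c_def d_def scaleR_sum_right)
    then show ?thesis by (simp add: ab)
  qed
  ultimately have "cstar_pos ((1/K^2) *\<^sub>R (K *\<^sub>R 1 - d) + ((1/K^2) *\<^sub>R d - (1/K) *\<^sub>R 1 - (1/K) *\<^sub>R 1 + c))"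
    using cstar_pos_add by metis
  also have "(1/K^2) *\<^sub>R (K *\<^sub>R 1 - d) + ((1/K^2) *\<^sub>R d - (1/K) *\<^sub>R 1 - (1/K) *\<^sub>R 1 + c) = c - (1/K) *\<^sub>R 1"
    using K by (simp add: algebra_simps power2_eq_square)
  finally obtain s where s: "norm (s *\<^sub>R 1 - (c - (1/K) *\<^sub>R 1)) \<le> s"
    by (auto simp: cstar_pos_def)
  \<comment> \<open>Enlarging the witness \<open>s\<close> by \<open>1 / K\<close> makes the norm of
    \<open>y = 1 - c / T\<close> at most \<open>s / T\<close>, strictly below 1. Thus
    \<open>c = T (1 - y)\<close> is invertible and has a self-adjoint root.\<close>
  define T where "T = s + 1/K"
  have "s \<ge> 0" using s norm_ge_zero order_trans by blast
  then have T: "T > 0" "s < T" using K by (auto simp: T_def add_nonneg_pos)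
  define y where "y = 1 - (1/T) *\<^sub>R c"
  have "y = (1/T) *\<^sub>R (s *\<^sub>R 1 - (c - (1/K) *\<^sub>R 1))"
    using T by (simp add: y_def T_def algebra_simps flip: scaleR_add_left)
  then have "norm y \<le> s / T"
    using s T by (simp add: divide_right_mono)
  then have ny: "norm y < 1"
    using T by (simp add: order_le_less_trans)
  have sy: "star y = y" by (simp add: y_def star_diff star_scaleR sc)
  obtain r where r: "star r = r" "r * r = 1 - y"
    using sqrt_one_minus[OF sy less_imp_le[OF ny]] by metis
  obtain z where z: "z * (1 - y) = 1" "(1 - y) * z = 1"
    using inverse_one_minus[OF ny] by metis
  \<comment> \<open>\<open>w\<close> is a right inverse of \<open>r\<close>, and the adjoint of
    \<open>r * w = 1\<close> shows that \<open>star w\<close> is a left inverse. Hence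
    \<open>s'\<close> below is \<open>c\<close> to the power \<open>-1/2\<close>.\<close>
  define w where "w = r * z"
  have rw: "r * w = 1" using z r by (simp add: w_def flip: mult.assoc)
  then have "star w * r = 1" by (metis r(1) star_mult star_one)
  then have sw: "star w = w" using rw by (metis mult.assoc mult_1 mult_1_right)
  have c: "c = T *\<^sub>R (r * r)" using T by (simp add: r y_def)
  define s' where "s' = (1 / sqrt T) *\<^sub>R w"
  have "(\<Sum>i\<in>I. star (b i * s') * (b i * s')) = star s' * c * s'"
    by (simp add: c_def star_mult sum_distrib_left sum_distrib_right mult.assoc)
  also have "\<dots> = (star w * r) * (r * w)"
    using T by (simp add: s'_def c star_scaleR mult.assoc)
  also have "\<dots> = 1" using rw \<open>star w * r = 1\<close> by simp
  finally show ?thesis by (rule that)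
qed

section \<open>Corner embeddings\<close>

text \<open>\<open>\<psi>\<close> is a *-isomorphism of \<open>A\<close> onto the corner \<open>p M\<^sub>I(A) p\<close>, where \<open>p = \<psi> 1\<close>; an arbitrary finite
  index set \<open>I\<close> spares the flattening of indices in iterated matrix algebras.\<close>

locale cstar_embedding =
  fixes I :: "'i set" and \<psi> :: "'a::unital_cstar_algebra \<Rightarrow> 'i \<Rightarrow> 'i \<Rightarrow> 'a"
  assumes fin: "finite I"
    and add: "i \<in> I \<Longrightarrow> j \<in> I \<Longrightarrow> \<psi> (x + y) i j = \<psi> x i j + \<psi> y i j"
    and scaleC: "i \<in> I \<Longrightarrow> j \<in> I \<Longrightarrow> \<psi> (c *\<^sub>C x) i j = c *\<^sub>C \<psi> x i j"
    and star: "i \<in> I \<Longrightarrow> j \<in> I \<Longrightarrow> \<psi> (star x) i j = star (\<psi> x j i)"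
    and mult: "i \<in> I \<Longrightarrow> j \<in> I \<Longrightarrow> \<psi> (x * y) i j = (\<Sum>k\<in>I. \<psi> x i k * \<psi> y k j)"
    and kernel: "(\<And>i j. i \<in> I \<Longrightarrow> j \<in> I \<Longrightarrow> \<psi> x i j = 0) \<Longrightarrow> x = 0"
    and onto: "(\<And>i j. i \<in> I \<Longrightarrow> j \<in> I \<Longrightarrow> (\<Sum>k\<in>I. \<psi> 1 i k * X k j) = X i j) \<Longrightarrow>
      (\<And>i j. i \<in> I \<Longrightarrow> j \<in> I \<Longrightarrow> (\<Sum>k\<in>I. X i k * \<psi> 1 k j) = X i j) \<Longrightarrow>
      \<exists>x. \<forall>i\<in>I. \<forall>j\<in>I. \<psi> x i j = X i j"
begin

lemma zero: "i \<in> I \<Longrightarrow> j \<in> I \<Longrightarrow> \<psi> 0 i j = 0"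
  using add[of i j 0 0] by simp

lemma sum: "i \<in> I \<Longrightarrow> j \<in> I \<Longrightarrow> \<psi> (\<Sum>m\<in>M. f m) i j = (\<Sum>m\<in>M. \<psi> (f m) i j)"
  by (induction M rule: infinite_finite_induct) (auto simp: zero add)

lemma eqI:
  assumes "\<And>i j. i \<in> I \<Longrightarrow> j \<in> I \<Longrightarrow> \<psi> x i j = \<psi> y i j"
  shows "x = y"
proof -
  \<comment> \<open>The difference is written with the scalar \<open>- 1\<close> so that
    \<open>add\<close> and \<open>scaleC\<close> of the locale apply.\<close>
  have "x + (- 1) *\<^sub>C y = 0"
  proof (rule kernel)
    fix i j assume "i \<in> I" "j \<in> I"
    then show "\<psi> (x + (- 1) *\<^sub>C y) i j = 0"
      by (simp only: add scaleC assms) (simp add: scaleC_minus_one)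
  qed
  then show ?thesis by (simp add: scaleC_minus_one)
qed

lemma one_star: "i \<in> I \<Longrightarrow> j \<in> I \<Longrightarrow> star (\<psi> 1 i j) = \<psi> 1 j i"
  using star[of j i 1] by simp

lemma one_left: "i \<in> I \<Longrightarrow> j \<in> I \<Longrightarrow> (\<Sum>k\<in>I. \<psi> 1 i k * \<psi> x k j) = \<psi> x i j"
  using mult[of i j 1 x] by simp

lemma one_right: "i \<in> I \<Longrightarrow> j \<in> I \<Longrightarrow> (\<Sum>k\<in>I. \<psi> x i k * \<psi> 1 k j) = \<psi> x i j"
  using mult[of i j x 1] by simp

definition trace :: "('a \<Rightarrow> complex) \<Rightarrow> 'a \<Rightarrow> complex" where
  "trace \<tau> x = (\<Sum>i\<in>I. \<tau> (\<psi> x i i))"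

text \<open>The normalized trace of the corner is a tracial state of \<open>A\<close>, hence equal to \<open>\<tau>\<close>.\<close>

lemma trace_eq:
  assumes "unique_tracial_state \<tau>" "trace \<tau> 1 = complex_of_real t" "t > 0"
  shows "trace \<tau> x = complex_of_real t * \<tau> x"
proof -
  have \<tau>: "tracial_state \<tau>"
    using assms by (simp add: unique_tracial_state_def)
  then have \<tau>_add: "\<tau> (x + y) = \<tau> x + \<tau> y" and \<tau>_scale: "\<tau> (c *\<^sub>C x) = c * \<tau> x"
    and \<tau>_pos: "\<tau> (star x * x) \<in> \<real>\<^sub>\<ge>\<^sub>0" and \<tau>_comm: "\<tau> (x * y) = \<tau> (y * x)" for x y c
    unfolding tracial_state_def by blast+
  define \<sigma> where "\<sigma> x = complex_of_real (inverse t) * trace \<tau> x" for x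
  have "tracial_state \<sigma>"
    unfolding tracial_state_def
  proof (intro conjI allI)
    fix x y c
    show "\<sigma> (x + y) = \<sigma> x + \<sigma> y"
      by (simp add: \<sigma>_def trace_def add \<tau>_add sum.distrib distrib_left)
    show "\<sigma> (c *\<^sub>C x) = c * \<sigma> x"
      by (simp add: \<sigma>_def trace_def scaleC \<tau>_scale sum_distrib_left mult_ac)
    have "trace \<tau> (star x * x) = (\<Sum>i\<in>I. \<Sum>k\<in>I. \<tau> (star (\<psi> x k i) * \<psi> x k i))"
      by (simp add: trace_def mult star tracial_state_sum[OF \<tau>])
    also have "\<dots> \<in> \<real>\<^sub>\<ge>\<^sub>0" by (intro nonneg_Reals_sum \<tau>_pos)
    finally show "\<sigma> (star x * x) \<in> \<real>\<^sub>\<ge>\<^sub>0"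
      unfolding \<sigma>_def using assms(3) by (intro nonneg_Reals_mult_I) auto
    show "\<sigma> 1 = 1" using assms by (simp add: \<sigma>_def)
    have "trace \<tau> (x * y) = (\<Sum>i\<in>I. \<Sum>k\<in>I. \<tau> (\<psi> x i k * \<psi> y k i))"
      by (simp add: trace_def mult tracial_state_sum[OF \<tau>])
    also have "\<dots> = (\<Sum>k\<in>I. \<Sum>i\<in>I. \<tau> (\<psi> y k i * \<psi> x i k))"
      by (subst sum.swap) (intro sum.cong refl \<tau>_comm)
    also have "\<dots> = trace \<tau> (y * x)"
      by (simp add: trace_def mult tracial_state_sum[OF \<tau>])
    finally show "\<sigma> (x * y) = \<sigma> (y * x)" by (simp add: \<sigma>_def)
  qed
  then have "\<sigma> x = \<tau> x"
    using assms(1) unfolding unique_tracial_state_def by blast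
  then show ?thesis
    using assms(3) by (auto simp: \<sigma>_def field_simps)
qed

end

text \<open>\<open>A\<close> as 1 by 1 matrices over itself; this puts 1 into the fundamental
  group.\<close>

lemma cstar_embedding_id: "cstar_embedding {()} (\<lambda>x _ _. x)"
  by unfold_locales auto

section \<open>Composition of corner embeddings\<close>

lemma sum_mult_swap_left:
  fixes c :: "'k \<Rightarrow> 'r::ring"
  shows "(\<Sum>k\<in>K. c k * (\<Sum>m\<in>M. \<Sum>n\<in>N. A k m n * X m n)) =
    (\<Sum>m\<in>M. \<Sum>n\<in>N. (\<Sum>k\<in>K. c k * A k m n) * X m n)"
proof -
  have "(\<Sum>k\<in>K. c k * (\<Sum>m\<in>M. \<Sum>n\<in>N. A k m n * X m n)) =
      (\<Sum>k\<in>K. \<Sum>m\<in>M. \<Sum>n\<in>N. c k * A k m n * X m n)"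
    by (simp add: sum_distrib_left mult.assoc)
  also have "\<dots> = (\<Sum>m\<in>M. \<Sum>k\<in>K. \<Sum>n\<in>N. c k * A k m n * X m n)"
    by (rule sum.swap)
  also have "\<dots> = (\<Sum>m\<in>M. \<Sum>n\<in>N. \<Sum>k\<in>K. c k * A k m n * X m n)"
    by (intro sum.cong refl sum.swap)
  finally show ?thesis by (simp add: sum_distrib_right)
qed

lemma sum_mult_swap_right:
  fixes c :: "'k \<Rightarrow> 'r::ring"
  shows "(\<Sum>k\<in>K. (\<Sum>m\<in>M. \<Sum>n\<in>N. X m n * A m n k) * c k) =
    (\<Sum>m\<in>M. \<Sum>n\<in>N. X m n * (\<Sum>k\<in>K. A m n k * c k))"
proof -
  have "(\<Sum>k\<in>K. (\<Sum>m\<in>M. \<Sum>n\<in>N. X m n * A m n k) * c k) =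
      (\<Sum>k\<in>K. \<Sum>m\<in>M. \<Sum>n\<in>N. X m n * (A m n k * c k))"
    by (simp add: sum_distrib_right mult.assoc)
  also have "\<dots> = (\<Sum>m\<in>M. \<Sum>k\<in>K. \<Sum>n\<in>N. X m n * (A m n k * c k))"
    by (rule sum.swap)
  also have "\<dots> = (\<Sum>m\<in>M. \<Sum>n\<in>N. \<Sum>k\<in>K. X m n * (A m n k * c k))"
    by (intro sum.cong refl sum.swap)
  finally show ?thesis by (simp add: sum_distrib_left)
qed

text \<open>\<open>\<psi>\<close> is applied to every entry of \<open>\<chi> x\<close>, which yields
  a block matrix over pairs of indices. Surjectivity goes in two stages: each block of
  \<open>X\<close> is pulled back along \<open>\<psi>\<close>, and the matrix \<open>Y\<close> of
  preimages then lies in the corner of \<open>\<chi> 1\<close>.\<close>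

lemma cstar_embedding_compose:
  fixes I :: "'i set" and J :: "'j set" and \<psi> :: "'a::unital_cstar_algebra \<Rightarrow> 'i \<Rightarrow> 'i \<Rightarrow> 'a"
  assumes "cstar_embedding I \<psi>" "cstar_embedding J \<chi>"
  shows "cstar_embedding (J \<times> I) (\<lambda>x u v. \<psi> (\<chi> x (fst u) (fst v)) (snd u) (snd v))"
proof -
  interpret P: cstar_embedding I \<psi> by fact
  interpret C: cstar_embedding J \<chi> by fact
  show ?thesis
  proof
    show "finite (J \<times> I)" using P.fin C.fin by simp
  next
    fix u v :: "'j \<times> 'i" and x y :: 'a
    assume "u \<in> J \<times> I" "v \<in> J \<times> I"
    then show "\<psi> (\<chi> (x + y) (fst u) (fst v)) (snd u) (snd v) =
        \<psi> (\<chi> x (fst u) (fst v)) (snd u) (snd v) + \<psi> (\<chi> y (fst u) (fst v)) (snd u) (snd v)"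
      by (auto simp: P.add C.add)
  next
    fix u v :: "'j \<times> 'i" and x :: 'a and c
    assume "u \<in> J \<times> I" "v \<in> J \<times> I"
    then show "\<psi> (\<chi> (c *\<^sub>C x) (fst u) (fst v)) (snd u) (snd v) =
        c *\<^sub>C \<psi> (\<chi> x (fst u) (fst v)) (snd u) (snd v)"
      by (auto simp: P.scaleC C.scaleC)
  next
    fix u v :: "'j \<times> 'i" and x :: 'a
    assume "u \<in> J \<times> I" "v \<in> J \<times> I"
    then show "\<psi> (\<chi> (star x) (fst u) (fst v)) (snd u) (snd v) =
        star (\<psi> (\<chi> x (fst v) (fst u)) (snd v) (snd u))"
      by (auto simp: C.star P.star)
  next
    fix u v :: "'j \<times> 'i" and x y :: 'a
    assume "u \<in> J \<times> I" "v \<in> J \<times> I"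
    then show "\<psi> (\<chi> (x * y) (fst u) (fst v)) (snd u) (snd v) =
        (\<Sum>w\<in>J \<times> I. \<psi> (\<chi> x (fst u) (fst w)) (snd u) (snd w) *
          \<psi> (\<chi> y (fst w) (fst v)) (snd w) (snd v))"
      by (auto simp: C.mult P.sum P.mult sum.cartesian_product case_prod_beta)
  next
    fix x :: 'a
    assume *: "\<And>u v. u \<in> J \<times> I \<Longrightarrow> v \<in> J \<times> I \<Longrightarrow> \<psi> (\<chi> x (fst u) (fst v)) (snd u) (snd v) = 0"
    show "x = 0"
    proof (rule C.kernel, rule P.kernel)
      fix i j k l assume "i \<in> J" "j \<in> J" "k \<in> I" "l \<in> I"
      then show "\<psi> (\<chi> x i j) k l = 0" using *[of "(i, k)" "(j, l)"] by simp
    qed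
  next
    fix X :: "'j \<times> 'i \<Rightarrow> 'j \<times> 'i \<Rightarrow> 'a"
    assume "\<And>u v. u \<in> J \<times> I \<Longrightarrow> v \<in> J \<times> I \<Longrightarrow>
      (\<Sum>w\<in>J \<times> I. \<psi> (\<chi> 1 (fst u) (fst w)) (snd u) (snd w) * X w v) = X u v"
    then have L: "(\<Sum>m\<in>J. \<Sum>n\<in>I. \<psi> (\<chi> 1 i m) k n * X (m, n) (j, l)) = X (i, k) (j, l)"
      if "i \<in> J" "j \<in> J" "k \<in> I" "l \<in> I" for i j k l
      using that by (fastforce simp: sum.cartesian_product case_prod_beta)
    assume "\<And>u v. u \<in> J \<times> I \<Longrightarrow> v \<in> J \<times> I \<Longrightarrow>
      (\<Sum>w\<in>J \<times> I. X u w * \<psi> (\<chi> 1 (fst w) (fst v)) (snd w) (snd v)) = X u v"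
    then have R: "(\<Sum>m\<in>J. \<Sum>n\<in>I. X (i, k) (m, n) * \<psi> (\<chi> 1 m j) n l) = X (i, k) (j, l)"
      if "i \<in> J" "j \<in> J" "k \<in> I" "l \<in> I" for i j k l
      using that by (fastforce simp: sum.cartesian_product case_prod_beta)
    \<comment> \<open>The blocks of the composite unit are values of \<open>\<psi>\<close>, so they
      absorb \<open>\<psi> 1\<close>; hence \<open>\<psi> 1\<close> fixes every block of
      \<open>X\<close> from both sides.\<close>
    have "\<exists>y. \<forall>k\<in>I. \<forall>l\<in>I. \<psi> y k l = X (i, k) (j, l)" if ij: "i \<in> J" "j \<in> J" for i j
    proof (rule P.onto)
      fix k l assume kl: "k \<in> I" "l \<in> I"
      have "(\<Sum>k'\<in>I. \<psi> 1 k k' * X (i, k') (j, l)) =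
          (\<Sum>k'\<in>I. \<psi> 1 k k' * (\<Sum>m\<in>J. \<Sum>n\<in>I. \<psi> (\<chi> 1 i m) k' n * X (m, n) (j, l)))"
        using ij kl by (intro sum.cong refl) (simp add: L)
      also have "\<dots> = (\<Sum>m\<in>J. \<Sum>n\<in>I. (\<Sum>k'\<in>I. \<psi> 1 k k' * \<psi> (\<chi> 1 i m) k' n) * X (m, n) (j, l))"
        by (rule sum_mult_swap_left)
      also have "\<dots> = X (i, k) (j, l)"
        using ij kl by (simp add: P.one_left L)
      finally show "(\<Sum>k'\<in>I. \<psi> 1 k k' * X (i, k') (j, l)) = X (i, k) (j, l)" .
      have "(\<Sum>k'\<in>I. X (i, k) (j, k') * \<psi> 1 k' l) =
          (\<Sum>k'\<in>I. (\<Sum>m\<in>J. \<Sum>n\<in>I. X (i, k) (m, n) * \<psi> (\<chi> 1 m j) n k') * \<psi> 1 k' l)"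
        using ij kl by (intro sum.cong refl) (simp add: R)
      also have "\<dots> = (\<Sum>m\<in>J. \<Sum>n\<in>I. X (i, k) (m, n) * (\<Sum>k'\<in>I. \<psi> (\<chi> 1 m j) n k' * \<psi> 1 k' l))"
        by (rule sum_mult_swap_right)
      also have "\<dots> = X (i, k) (j, l)"
        using ij kl by (simp add: P.one_right R)
      finally show "(\<Sum>k'\<in>I. X (i, k) (j, k') * \<psi> 1 k' l) = X (i, k) (j, l)" .
    qed
    then obtain Y where Y: "\<And>i j k l. i \<in> J \<Longrightarrow> j \<in> J \<Longrightarrow> k \<in> I \<Longrightarrow> l \<in> I \<Longrightarrow>
        \<psi> (Y i j) k l = X (i, k) (j, l)"
      by metis
    have "\<exists>x. \<forall>i\<in>J. \<forall>j\<in>J. \<chi> x i j = Y i j"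
    \<comment> \<open>Injectivity of \<open>\<psi>\<close> reduces the corner equations for
      \<open>Y\<close> to \<open>L\<close> and \<open>R\<close>.\<close>
    proof (rule C.onto; rule P.eqI)
      fix i j k l assume "i \<in> J" "j \<in> J" "k \<in> I" "l \<in> I"
      then show "\<psi> (\<Sum>m\<in>J. \<chi> 1 i m * Y m j) k l = \<psi> (Y i j) k l"
        "\<psi> (\<Sum>m\<in>J. Y i m * \<chi> 1 m j) k l = \<psi> (Y i j) k l"
        by (simp_all add: P.sum P.mult Y L R)
    qed
    then obtain x where x: "\<And>i j. i \<in> J \<Longrightarrow> j \<in> J \<Longrightarrow> \<chi> x i j = Y i j"
      by blast
    show "\<exists>x. \<forall>u\<in>J \<times> I. \<forall>v\<in>J \<times> I. \<psi> (\<chi> x (fst u) (fst v)) (snd u) (snd v) = X u v"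
      by (rule exI[of _ x]) (auto simp: x Y)
  qed
qed

text \<open>The matrices \<open>W x W\<^sup>*\<close> form a corner of the matrix algebra \<open>M\<^sub>M\<close> over \<open>\<psi>(A) = p M\<^sub>I(A) p\<close>; \<open>\<rho>\<close> is obtained
  by reading \<open>\<psi>(A)\<close> as \<open>A\<close>.\<close>

lemma (in cstar_embedding) ex_inverse_embedding:
  assumes M: "finite M" and W: "(\<Sum>m\<in>M. \<Sum>k\<in>I. star (W m k) * W m k) = 1"
    and pW: "\<And>m k. m \<in> M \<Longrightarrow> k \<in> I \<Longrightarrow> (\<Sum>l\<in>I. \<psi> 1 k l * W m l) = W m k"
  shows "\<exists>\<rho>. cstar_embedding M \<rho> \<and>
    (\<forall>x. \<forall>m\<in>M. \<forall>n\<in>M. \<forall>k\<in>I. \<forall>l\<in>I. \<psi> (\<rho> x m n) k l = W m k * x * star (W n l))"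
proof -
  have Wp: "(\<Sum>l\<in>I. star (W m l) * \<psi> 1 l k) = star (W m k)" if "m \<in> M" "k \<in> I" for m k
    using arg_cong[OF pW[OF that], of star] that by (simp add: star_sum star_mult one_star)
  \<comment> \<open>The outer factors absorb \<open>\<psi> 1\<close> on either side, so the matrix
    lies in the corner and has a preimage.\<close>
  have ex: "\<exists>r. \<forall>k\<in>I. \<forall>l\<in>I. \<psi> r k l = W m k * x * star (W n l)" if "m \<in> M" "n \<in> M" for x m n
  proof (rule onto)
    fix k l assume kl: "k \<in> I" "l \<in> I"
    have "(\<Sum>u\<in>I. \<psi> 1 k u * (W m u * x * star (W n l))) = (\<Sum>u\<in>I. \<psi> 1 k u * W m u) * (x * star (W n l))"
      by (simp add: sum_distrib_right mult.assoc)
    then show "(\<Sum>u\<in>I. \<psi> 1 k u * (W m u * x * star (W n l))) = W m k * x * star (W n l)"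
      using that kl by (simp add: pW mult.assoc)
    have "(\<Sum>u\<in>I. W m k * x * star (W n u) * \<psi> 1 u l) = W m k * x * (\<Sum>u\<in>I. star (W n u) * \<psi> 1 u l)"
      by (simp add: sum_distrib_left mult.assoc)
    then show "(\<Sum>u\<in>I. W m k * x * star (W n u) * \<psi> 1 u l) = W m k * x * star (W n l)"
      using that kl by (simp add: Wp)
  qed
  define \<rho> where "\<rho> x m n = (SOME r. \<forall>k\<in>I. \<forall>l\<in>I. \<psi> r k l = W m k * x * star (W n l))" for x m n
  have \<rho>: "\<psi> (\<rho> x m n) k l = W m k * x * star (W n l)"
    if "m \<in> M" "n \<in> M" "k \<in> I" "l \<in> I" for x m n k l
    using someI_ex[OF ex[OF that(1,2)], of x] that(3,4) unfolding \<rho>_def by blast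
  have emb: "cstar_embedding M \<rho>"
  proof
    show "finite M" by fact
  next
    fix m n x y assume "m \<in> M" "n \<in> M"
    then show "\<rho> (x + y) m n = \<rho> x m n + \<rho> y m n"
      by - (rule eqI, simp add: add \<rho> distrib_left distrib_right)
  next
    fix m n x c assume "m \<in> M" "n \<in> M"
    then show "\<rho> (c *\<^sub>C x) m n = c *\<^sub>C \<rho> x m n"
      by - (rule eqI, simp add: scaleC \<rho> mult_scaleC_left mult_scaleC_right)
  next
    fix m n x assume "m \<in> M" "n \<in> M"
    then show "\<rho> (star x) m n = star (\<rho> x n m)"
      by - (rule eqI, simp add: star \<rho> star_mult star_star mult.assoc)
  next
    fix m n x y assume mn: "m \<in> M" "n \<in> M"
    show "\<rho> (x * y) m n = (\<Sum>p\<in>M. \<rho> x m p * \<rho> y p n)"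
    proof (rule eqI)
      fix k l assume kl: "k \<in> I" "l \<in> I"
      have "\<psi> (\<Sum>p\<in>M. \<rho> x m p * \<rho> y p n) k l =
          (\<Sum>p\<in>M. \<Sum>q\<in>I. W m k * x * (star (W p q) * W p q) * (y * star (W n l)))"
        using mn kl by (simp add: sum mult \<rho> mult.assoc)
      \<comment> \<open>The inner double sum is \<open>W\<^sup>* W = 1\<close>.\<close>
      also have "\<dots> = W m k * x * 1 * (y * star (W n l))"
        unfolding W[symmetric] by (simp add: sum_distrib_left sum_distrib_right)
      finally show "\<psi> (\<rho> (x * y) m n) k l = \<psi> (\<Sum>p\<in>M. \<rho> x m p * \<rho> y p n) k l"
        using mn kl by (simp add: \<rho> mult.assoc)
    qed
  next
    fix x assume "\<And>m n. m \<in> M \<Longrightarrow> n \<in> M \<Longrightarrow> \<rho> x m n = 0"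
    then have *: "W m k * x * star (W n l) = 0" if "m \<in> M" "n \<in> M" "k \<in> I" "l \<in> I" for m n k l
      using \<rho>[OF that, of x] that by (simp add: zero)
    \<comment> \<open>Multiplying by \<open>W\<^sup>* W = 1\<close> on both sides recovers
      \<open>x\<close> from the entries of \<open>W x W\<^sup>*\<close>.\<close>
    have "x = (\<Sum>m\<in>M. \<Sum>k\<in>I. star (W m k) * W m k) * x * (\<Sum>n\<in>M. \<Sum>l\<in>I. star (W n l) * W n l)"
      by (simp add: W)
    also have "\<dots> = (\<Sum>n\<in>M. \<Sum>l\<in>I. \<Sum>m\<in>M. \<Sum>k\<in>I. star (W m k) * (W m k * x * star (W n l)) * W n l)"
      by (simp add: sum_distrib_left sum_distrib_right mult.assoc)
    also have "\<dots> = 0" by (simp add: *)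
    finally show "x = 0" .
  next
    fix X
    assume L: "\<And>m n. m \<in> M \<Longrightarrow> n \<in> M \<Longrightarrow> (\<Sum>p\<in>M. \<rho> 1 m p * X p n) = X m n"
      and R: "\<And>m n. m \<in> M \<Longrightarrow> n \<in> M \<Longrightarrow> (\<Sum>p\<in>M. X m p * \<rho> 1 p n) = X m n"
    \<comment> \<open>The preimage is \<open>W\<^sup>* X W\<close>, with the entries of
      \<open>X\<close> read through \<open>\<psi>\<close>. Since \<open>\<rho> 1\<close> corresponds
      to \<open>W W\<^sup>*\<close>, the equations \<open>L\<close> and \<open>R\<close> give back
      \<open>X\<close>.\<close>
    define a where "a = (\<Sum>p\<in>M. \<Sum>q\<in>M. \<Sum>u\<in>I. \<Sum>v\<in>I. star (W p u) * \<psi> (X p q) u v * W q v)"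
    have "\<rho> a m n = X m n" if mn: "m \<in> M" "n \<in> M" for m n
    proof (rule eqI)
      fix k l assume kl: "k \<in> I" "l \<in> I"
      have "\<psi> (X m n) k l = \<psi> (\<Sum>p\<in>M. \<rho> 1 m p * (\<Sum>q\<in>M. X p q * \<rho> 1 q n)) k l"
        using mn by (simp add: L R)
      also have "\<dots> = (\<Sum>p\<in>M. \<Sum>q\<in>M. \<Sum>u\<in>I. \<Sum>v\<in>I.
          W m k * (star (W p u) * \<psi> (X p q) u v * W q v) * star (W n l))"
        using mn kl by (simp add: sum mult \<rho> sum_distrib_left mult.assoc)
      also have "\<dots> = W m k * a * star (W n l)"
        by (simp add: a_def sum_distrib_left sum_distrib_right mult.assoc)
      finally show "\<psi> (\<rho> a m n) k l = \<psi> (X m n) k l"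
        using mn kl by (simp add: \<rho>)
    qed
    then show "\<exists>x. \<forall>m\<in>M. \<forall>n\<in>M. \<rho> x m n = X m n" by blast
  qed
  show ?thesis by (rule exI[of _ \<rho>]) (simp add: emb \<rho>)
qed

section \<open>Fullness of corners\<close>

text \<open>The algebraic ideal \<open>J\<close> generated by \<open>d\<close> is dense, so it
  contains some \<open>y\<close> within distance 1 of the unit. Such a \<open>y\<close> is
  invertible, which brings 1 itself into \<open>J\<close>.\<close>

lemma simple_cstar_sum_eq_1:
  fixes d :: "'a::unital_cstar_algebra"
  assumes simple: "simple_cstar TYPE('a)" and d: "d \<noteq> 0"
  obtains n :: nat and a b where "(\<Sum>i<n. a i * d * b i) = 1"
proof -
  define J where "J = {x. \<exists>(n::nat) a b. x = (\<Sum>i<n. a i * d * b i)}"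
  have JI: "(\<Sum>i<n. a i * d * b i) \<in> J" for n :: nat and a b
    unfolding J_def by auto
  have J0: "0 \<in> J" using JI[where n = 0] by simp
  have Jd: "d \<in> J"
    using JI[where n = 1 and a = "\<lambda>_. 1" and b = "\<lambda>_. 1"] by simp
  have Jadd: "x + y \<in> J" if xy: "x \<in> J" "y \<in> J" for x y
  proof -
    from xy obtain n m :: nat and a b a' b'
      where x: "x = (\<Sum>i<n. a i * d * b i)" and y: "y = (\<Sum>i<m. a' i * d * b' i)"
      unfolding J_def by auto
    \<comment> \<open>The two coefficient families are concatenated, the second one shifted by
      \<open>n\<close>.\<close>
    have "(\<Sum>i<n + m. f i) = (\<Sum>i<n. f i) + (\<Sum>i<m. f (n + i))" for f :: "nat \<Rightarrow> 'a"
      by (induction m) (auto simp: add.assoc)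
    then have "x + y = (\<Sum>i<n + m. (if i < n then a i else a' (i - n)) * d *
        (if i < n then b i else b' (i - n)))"
      by (simp add: x y)
    then show ?thesis by (simp only: JI)
  qed
  have Jmult: "c * x \<in> J \<and> x * c \<in> J" if "x \<in> J" for x c
  proof -
    from that obtain n :: nat and a b where x: "x = (\<Sum>i<n. a i * d * b i)" unfolding J_def by auto
    have "c * x = (\<Sum>i<n. (c * a i) * d * b i)" "x * c = (\<Sum>i<n. a i * d * (b i * c))"
      by (simp_all add: x sum_distrib_left sum_distrib_right mult.assoc)
    then show ?thesis by (simp only: JI)
  qed
  have "closed_ideal (closure J)"
    unfolding closed_ideal_def
  proof (intro conjI ballI allI)
    show "0 \<in> closure J" using J0 closure_subset by blast
    fix x assume "x \<in> closure J"
    then obtain f where f: "\<And>n. f n \<in> J" "f \<longlonglongrightarrow> x" by (auto simp: closure_sequential)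
    fix c
    have "(\<lambda>n. c * f n) \<longlonglongrightarrow> c * x" "(\<lambda>n. f n * c) \<longlonglongrightarrow> x * c"
      by (intro tendsto_intros f)+
    moreover have "c * f n \<in> J" "f n * c \<in> J" for n using Jmult f(1) by auto
    ultimately show "c * x \<in> closure J" "x * c \<in> closure J"
      unfolding closure_sequential
      by (auto intro: exI[of _ "\<lambda>n. c * f n"] exI[of _ "\<lambda>n. f n * c"])
  next
    fix x y assume "x \<in> closure J" "y \<in> closure J"
    then obtain f g where f: "\<And>n. f n \<in> J" "f \<longlonglongrightarrow> x" and g: "\<And>n. g n \<in> J" "g \<longlonglongrightarrow> y"
      by (auto simp: closure_sequential)
    have "(\<lambda>n. f n + g n) \<longlonglongrightarrow> x + y" by (intro tendsto_intros f g)
    moreover have "f n + g n \<in> J" for n using Jadd f(1) g(1) by auto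
    ultimately show "x + y \<in> closure J"
      unfolding closure_sequential by (auto intro: exI[of _ "\<lambda>n. f n + g n"])
  qed simp
  moreover have "closure J \<noteq> {0}" using Jd d closure_subset by blast
  ultimately have "closure J = UNIV"
    using simple unfolding simple_cstar_def by blast
  then have "(1::'a) \<in> closure J" by simp
  then have "\<exists>y\<in>J. dist y 1 < 1"
    unfolding closure_approachable by - (drule spec[of _ 1], simp)
  then obtain y where y: "y \<in> J" "dist y 1 < 1" by (elim bexE)
  then have "norm (1 - y) < 1" by (simp add: dist_norm norm_minus_commute)
  then obtain z where "y * z = 1"
    using inverse_one_minus[of "1 - y"] by auto
  then have "1 \<in> J" using Jmult[OF y(1), of z] by simp
  then obtain n :: nat and a b where "1 = (\<Sum>i<n. a i * d * b i)"
    unfolding J_def by auto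
  then show ?thesis by (intro that) (rule sym)
qed

text \<open>Idempotence expands the nonzero entry \<open>\<psi> 1 r c\<close> through row
  \<open>r\<close> and column \<open>c\<close> of the unit. In the sum given by simplicity the right
  factors are then multiples of column \<open>c\<close>, hence in the range of
  \<open>\<psi> 1\<close>, and normalizing by \<open>s\<close> on the right keeps them
  there.\<close>

lemma (in cstar_embedding) ex_unit_column:
  assumes "simple_cstar TYPE('a)" "r \<in> I" "c \<in> I" "\<psi> 1 r c \<noteq> 0"
  obtains n :: nat and W where "(\<Sum>m<n. \<Sum>k\<in>I. star (W m k) * W m k) = 1"
    "\<And>m k. k \<in> I \<Longrightarrow> (\<Sum>l\<in>I. \<psi> 1 k l * W m l) = W m k"
proof -
  obtain n :: nat and a b where ab: "(\<Sum>i<n. a i * \<psi> 1 r c * b i) = 1"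
    using simple_cstar_sum_eq_1[OF assms(1,4)] by metis
  have "(\<Sum>i<n. a i * \<psi> 1 r c * b i) = (\<Sum>i<n. \<Sum>k\<in>I. (a i * \<psi> 1 r k) * (\<psi> 1 k c * b i))"
  proof (rule sum.cong[OF refl])
    fix i
    have "(\<Sum>k\<in>I. (a i * \<psi> 1 r k) * (\<psi> 1 k c * b i)) = a i * (\<Sum>k\<in>I. \<psi> 1 r k * \<psi> 1 k c) * b i"
      by (simp add: sum_distrib_left sum_distrib_right mult.assoc)
    then show "a i * \<psi> 1 r c * b i = (\<Sum>k\<in>I. (a i * \<psi> 1 r k) * (\<psi> 1 k c * b i))"
      using assms by (simp add: one_left)
  qed
  then have "(\<Sum>(i, k)\<in>{..<n} \<times> I. (a i * \<psi> 1 r k) * (\<psi> 1 k c * b i)) = 1"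
    using ab by (simp add: sum.cartesian_product)
  then have "(\<Sum>u\<in>{..<n} \<times> I. (a (fst u) * \<psi> 1 r (snd u)) * (\<psi> 1 (snd u) c * b (fst u))) = 1"
    by (simp add: case_prod_beta)
  then obtain s where s: "(\<Sum>u\<in>{..<n} \<times> I. star (\<psi> 1 (snd u) c * b (fst u) * s) * (\<psi> 1 (snd u) c * b (fst u) * s)) = 1"
    by (rule ex_normalized_column)
  show ?thesis
  proof (rule that[where n = n and W = "\<lambda>m k. \<psi> 1 k c * b m * s"])
    show "(\<Sum>m<n. \<Sum>k\<in>I. star (\<psi> 1 k c * b m * s) * (\<psi> 1 k c * b m * s)) = 1"
      using s by (simp add: sum.cartesian_product case_prod_beta)
    fix m k assume "k \<in> I"
    have "(\<Sum>l\<in>I. \<psi> 1 k l * (\<psi> 1 l c * b m * s)) = (\<Sum>l\<in>I. \<psi> 1 k l * \<psi> 1 l c) * (b m * s)"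
      by (simp add: sum_distrib_right mult.assoc)
    then show "(\<Sum>l\<in>I. \<psi> 1 k l * (\<psi> 1 l c * b m * s)) = \<psi> 1 k c * b m * s"
      using \<open>k \<in> I\<close> assms by (simp add: one_left mult.assoc)
  qed
qed

section \<open>The integral group ring of a commutative monoid of reals\<close>

lemmas frag_keys_induct = free_Abelian_group_induct[consumes 1, case_names zero diff gen]

lemma frag_induct [case_names zero diff gen]:
  assumes "P 0" "\<And>c d. P c \<Longrightarrow> P d \<Longrightarrow> P (c - d)" "\<And>t. P (frag_of t)"
  shows "P c"
  by (rule free_Abelian_group_induct[of c UNIV]) (use assms in auto)

section \<open>Evaluation of formal sums at real numbers\<close>

definition frag_eval :: "(real \<Rightarrow>\<^sub>0 int) \<Rightarrow> real" where
  "frag_eval c = (\<Sum>t\<in>Poly_Mapping.keys c. of_int (Poly_Mapping.lookup c t) * t)"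

lemma frag_eval_superset:
  assumes "finite S" "Poly_Mapping.keys c \<subseteq> S"
  shows "frag_eval c = (\<Sum>t\<in>S. of_int (Poly_Mapping.lookup c t) * t)"
  unfolding frag_eval_def
  by (rule sum.mono_neutral_left) (use assms in \<open>auto simp: in_keys_iff\<close>)

lemma frag_eval_diff: "frag_eval (c - d) = frag_eval c - frag_eval d"
proof -
  let ?S = "Poly_Mapping.keys c \<union> Poly_Mapping.keys d"
  have "frag_eval (c - d) = (\<Sum>t\<in>?S. of_int (Poly_Mapping.lookup (c - d) t) * t)"
    by (rule frag_eval_superset) (auto dest: subsetD[OF keys_diff])
  also have "\<dots> = frag_eval c - frag_eval d"
    by (simp add: frag_eval_superset[of ?S] lookup_minus left_diff_distrib sum_subtractf)
  finally show ?thesis .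
qed

lemma frag_eval_0 [simp]: "frag_eval 0 = 0"
  by (simp add: frag_eval_def)

lemma frag_eval_of [simp]: "frag_eval (frag_of t) = t"
  by (simp add: frag_eval_def)

lemma frag_eval_add: "frag_eval (c + d) = frag_eval c + frag_eval d"
  using frag_eval_diff[of c "- d"] frag_eval_diff[of 0 d] by simp

text \<open>Induction over generators and differences: \<open>F\<close> maps \<open>E\<close> into
  itself, and \<open>E\<close> is closed under differences.\<close>

lemma frag_eval_closed:
  assumes "Poly_Mapping.keys c \<subseteq> F" "x \<in> E"
    and "\<And>t y. t \<in> F \<Longrightarrow> y \<in> E \<Longrightarrow> t * y \<in> E"
    and "0 \<in> E" "\<And>y z. y \<in> E \<Longrightarrow> z \<in> E \<Longrightarrow> y - z \<in> E"
  shows "frag_eval c * x \<in> E"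
  using assms(1)
  by (induction c rule: frag_keys_induct)
     (use assms in \<open>auto simp: frag_eval_diff left_diff_distrib\<close>)

section \<open>The convolution product\<close>

definition frag_times :: "(real \<Rightarrow>\<^sub>0 int) \<Rightarrow> (real \<Rightarrow>\<^sub>0 int) \<Rightarrow> (real \<Rightarrow>\<^sub>0 int)" where
  "frag_times c d = frag_extend (\<lambda>s. frag_extend (\<lambda>t. frag_of (s * t)) d) c"

text \<open>Serves additivity of \<open>frag_times\<close> in its second factor, which sits inside
  the function being extended.\<close>

lemma frag_extend_diff_fun: "frag_extend (\<lambda>x. f x - g x) c = frag_extend f c - frag_extend g c"
  by (induction c rule: frag_induct) (auto simp: frag_extend_diff)

lemma frag_times_0 [simp]: "frag_times 0 d = 0" "frag_times c 0 = 0"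
  by (auto simp: frag_times_def frag_extend_eq_0)

lemma frag_times_diff_left: "frag_times (c - c') d = frag_times c d - frag_times c' d"
  by (simp add: frag_times_def frag_extend_diff)

lemma frag_times_diff_right: "frag_times c (d - d') = frag_times c d - frag_times c d'"
  by (simp add: frag_times_def frag_extend_diff frag_extend_diff_fun)

lemma frag_times_of [simp]: "frag_times (frag_of s) (frag_of t) = frag_of (s * t)"
  by (simp add: frag_times_def)

lemma frag_times_add_left: "frag_times (c + c') d = frag_times c d + frag_times c' d"
  using frag_times_diff_left[of c "- c'" d] frag_times_diff_left[of 0 c' d] by simp

lemma frag_times_keys:
  assumes "Poly_Mapping.keys c \<subseteq> F" "Poly_Mapping.keys d \<subseteq> F" "\<And>s t. s \<in> F \<Longrightarrow> t \<in> F \<Longrightarrow> s * t \<in> F"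
  shows "Poly_Mapping.keys (frag_times c d) \<subseteq> F"
  using assms(1)
proof (induction c rule: frag_keys_induct)
  case (gen s)
  show ?case using assms(2)
  proof (induction d rule: frag_keys_induct)
    case (diff x y)
    then show ?case
      using keys_diff[of "frag_times (frag_of s) x" "frag_times (frag_of s) y"]
      by (auto simp: frag_times_diff_right)
  qed (use gen assms in auto)
next
  case (diff x y)
  then show ?case
    using keys_diff[of "frag_times x d" "frag_times y d"] by (auto simp: frag_times_diff_left)
qed auto

lemma frag_times_commute: "frag_times c d = frag_times d c"
proof (induction c rule: frag_induct)
  case (gen s)
  show ?case
    by (induction d rule: frag_induct)
       (auto simp: frag_times_diff_left frag_times_diff_right mult.commute)
qed (auto simp: frag_times_diff_left frag_times_diff_right)

lemma frag_times_assoc: "frag_times (frag_times c d) e = frag_times c (frag_times d e)"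
proof (induction c rule: frag_induct)
  case (gen s)
  show ?case
  proof (induction d rule: frag_induct)
    case (gen t)
    show ?case
      by (induction e rule: frag_induct)
         (auto simp: frag_times_diff_left frag_times_diff_right mult.assoc)
  qed (auto simp: frag_times_diff_left frag_times_diff_right)
qed (auto simp: frag_times_diff_left frag_times_diff_right)

lemma frag_times_1: "frag_times (frag_of 1) d = d"
  by (induction d rule: frag_induct) (auto simp: frag_times_diff_right)

text \<open>Both sides are biadditive and agree on generators. Multiplicativity of the evaluation is
  what the associativity law of the module rests on.\<close>

lemma frag_eval_times: "frag_eval (frag_times c d) = frag_eval c * frag_eval d"
proof (induction c rule: frag_induct)
  case (gen s)
  show ?case
    by (induction d rule: frag_induct)
       (auto simp: frag_times_diff_right frag_eval_diff right_diff_distrib)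
qed (auto simp: frag_times_diff_left frag_eval_diff left_diff_distrib)

lemma int_group_ring_mult_reals:
  "int_group_ring (mult_reals F) =
     \<lparr>carrier = {c. Poly_Mapping.keys c \<subseteq> F}, monoid.mult = frag_times, one = frag_of 1,
      zero = 0, add = (+)\<rparr>"
  by (simp add: int_group_ring_def mult_reals_def frag_times_def[abs_def])

lemma cring_int_group_ring:
  assumes "1 \<in> F" "\<And>s t. s \<in> F \<Longrightarrow> t \<in> F \<Longrightarrow> s * t \<in> F"
  shows "cring (int_group_ring (mult_reals F))"
proof (rule cringI)
  show "abelian_group (int_group_ring (mult_reals F))"
  proof (rule abelian_groupI)
    fix x assume "x \<in> carrier (int_group_ring (mult_reals F))"
    then have "- x \<in> carrier (int_group_ring (mult_reals F))"
      by (simp add: int_group_ring_mult_reals)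
    then show "\<exists>y\<in>carrier (int_group_ring (mult_reals F)).
        y \<oplus>\<^bsub>int_group_ring (mult_reals F)\<^esub> x = \<zero>\<^bsub>int_group_ring (mult_reals F)\<^esub>"
      by (rule rev_bexI) (simp add: int_group_ring_mult_reals)
  qed (auto simp: int_group_ring_mult_reals dest: subsetD[OF keys_add])
  show "comm_monoid (int_group_ring (mult_reals F))"
    by (rule comm_monoidI)
       (use assms in \<open>auto simp: int_group_ring_mult_reals frag_times_assoc frag_times_1
          dest: subsetD[OF frag_times_keys] intro: frag_times_commute\<close>)
qed (auto simp: int_group_ring_mult_reals frag_times_add_left)

text \<open>Scalars act through the ring homomorphism \<open>frag_eval\<close>, so the module laws
  are those of real arithmetic; \<open>frag_eval_closed\<close> keeps the action inside
  \<open>E\<close>.\<close>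

lemma module_real_module:
  assumes F: "1 \<in> F" "\<And>s t. s \<in> F \<Longrightarrow> t \<in> F \<Longrightarrow> s * t \<in> F"
    and E: "0 \<in> E" "\<And>y z. y \<in> E \<Longrightarrow> z \<in> E \<Longrightarrow> y - z \<in> E"
    and FE: "\<And>t y. t \<in> F \<Longrightarrow> y \<in> E \<Longrightarrow> t * y \<in> E"
  shows "module (int_group_ring (mult_reals F)) (real_module E)"
proof (rule moduleI)
  have neg: "- y \<in> E" if "y \<in> E" for y using E(2)[OF E(1) that] by simp
  have add: "y + z \<in> E" if "y \<in> E" "z \<in> E" for y z
    using E(2)[OF that(1) neg[OF that(2)]] by simp
  show "abelian_group (real_module E)"
  proof (rule abelian_groupI)
    fix x assume "x \<in> carrier (real_module E)"
    then have "- x \<in> carrier (real_module E)" by (simp add: real_module_def neg)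
    then show "\<exists>y\<in>carrier (real_module E). y \<oplus>\<^bsub>real_module E\<^esub> x = \<zero>\<^bsub>real_module E\<^esub>"
      by (rule rev_bexI) (simp add: real_module_def)
  qed (auto simp: real_module_def E add)
  have smult: "c \<odot>\<^bsub>real_module E\<^esub> x = frag_eval c * x" for c x
    by (simp add: real_module_def frag_eval_def)
  fix c x assume "c \<in> carrier (int_group_ring (mult_reals F))" "x \<in> carrier (real_module E)"
  then show "c \<odot>\<^bsub>real_module E\<^esub> x \<in> carrier (real_module E)"
    unfolding smult using E FE
    by (auto simp: int_group_ring_mult_reals real_module_def intro: frag_eval_closed)
qed (use F in \<open>auto simp: real_module_def int_group_ring_mult_reals distrib_left
    frag_eval_add frag_eval_times mult.assoc distrib_right simp flip: frag_eval_def
    intro!: cring_int_group_ring[unfolded int_group_ring_mult_reals]\<close>)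

section \<open>The fundamental group and the range of the trace\<close>

definition index_mat :: "nat \<Rightarrow> (nat \<Rightarrow> 'i) \<Rightarrow> ('i \<Rightarrow> 'i \<Rightarrow> 'a) \<Rightarrow> 'a mat" where
  "index_mat n h X = mat n n (\<lambda>(i, j). X (h i) (h j))"

lemma index_mat_carrier [simp]: "index_mat n h X \<in> carrier_mat n n"
  by (simp add: index_mat_def)

lemma index_mat_dim [simp]: "dim_row (index_mat n h X) = n" "dim_col (index_mat n h X) = n"
  by (simp_all add: index_mat_def)

lemma index_mat_index [simp]: "i < n \<Longrightarrow> j < n \<Longrightarrow> index_mat n h X $$ (i, j) = X (h i) (h j)"
  by (simp add: index_mat_def)

lemma index_mat_cong:
  assumes "bij_betw h {..<n} I" "\<And>i j. i \<in> I \<Longrightarrow> j \<in> I \<Longrightarrow> X i j = Y i j"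
  shows "index_mat n h X = index_mat n h Y"
proof -
  have "h i \<in> I" if "i < n" for i using bij_betwE[OF assms(1)] that by auto
  then show ?thesis by (intro eq_matI) (auto simp: assms(2))
qed

lemma index_mat_inject:
  assumes h: "bij_betw h {..<n} I" and eq: "index_mat n h X = index_mat n h Y" and ij: "i \<in> I" "j \<in> I"
  shows "X i j = Y i j"
proof -
  obtain k l where "k < n" "l < n" "i = h k" "j = h l"
    using h ij by (auto simp: bij_betw_def)
  then show ?thesis using arg_cong[OF eq, of "\<lambda>A. A $$ (k, l)"] by simp
qed

lemma ex_index_mat:
  assumes h: "bij_betw h {..<n} I" and A: "A \<in> carrier_mat n n"
  shows "\<exists>X. A = index_mat n h X"
proof
  have "inv_into {..<n} h (h i) = i" if "i < n" for i
    using h that by (auto simp: bij_betw_def)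
  then show "A = index_mat n h (\<lambda>i j. A $$ (inv_into {..<n} h i, inv_into {..<n} h j))"
    using A by (intro eq_matI) auto
qed

lemma index_mat_mult:
  assumes "bij_betw h {..<n} I"
  shows "index_mat n h X * index_mat n h Y = index_mat n h (\<lambda>i j. \<Sum>k\<in>I. X i k * Y k j)"
  by (rule eq_matI)
     (auto simp: scalar_prod_def atLeast0LessThan sum.reindex_bij_betw[OF assms, symmetric])

lemma index_mat_star: "mat_star (index_mat n h X) = index_mat n h (\<lambda>i j. star (X j i))"
  by (rule eq_matI) auto

lemma tensor_Tr_index_mat:
  assumes "bij_betw h {..<n} I"
  shows "tensor_Tr \<tau> (index_mat n h X) = (\<Sum>i\<in>I. \<tau> (X i i))"
  by (simp add: tensor_Tr_def sum.reindex_bij_betw[OF assms, symmetric])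

lemma index_mat_projection:
  assumes "bij_betw h {..<n} I"
    and "\<And>i j. i \<in> I \<Longrightarrow> j \<in> I \<Longrightarrow> (\<Sum>k\<in>I. X i k * X k j) = X i j"
    and "\<And>i j. i \<in> I \<Longrightarrow> j \<in> I \<Longrightarrow> star (X j i) = X i j"
  shows "index_mat n h X \<in> projections n"
  unfolding projections_def
  using index_mat_cong[OF assms(1,2)] index_mat_cong[OF assms(1,3)]
  by (simp add: index_mat_mult[OF assms(1)] index_mat_star)

lemma ex_index_bij: "finite I \<Longrightarrow> \<exists>(n::nat) h. bij_betw h {..<n} I"
  using ex_bij_betw_nat_finite[of I] by (auto simp: atLeast0LessThan)

text \<open>Idempotence of \<open>p\<close> turns the existential in \<open>corner\<close> into two
  equations, which have the shape of the premises of \<open>onto\<close>.\<close>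

lemma corner_iff:
  assumes "p \<in> projections n"
  shows "X \<in> corner n p \<longleftrightarrow> X \<in> carrier_mat n n \<and> p * X = X \<and> X * p = X"
proof
  have p: "p \<in> carrier_mat n n" "p * p = p" using assms by (auto simp: projections_def)
  assume "X \<in> corner n p"
  then obtain A where A: "A \<in> carrier_mat n n" "X = p * A * p" by (auto simp: corner_def)
  have "p * (p * A * p) = (p * p) * A * p" "p * A * p * p = p * A * (p * p)"
    using p(1) A(1) by (simp_all add: assoc_mult_mat[of _ n n _ n _ n])
  then show "X \<in> carrier_mat n n \<and> p * X = X \<and> X * p = X"
    using p A by simp
next
  assume "X \<in> carrier_mat n n \<and> p * X = X \<and> X * p = X"
  then show "X \<in> corner n p"
    unfolding corner_def by (intro CollectI exI[of _ X]) simp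
qed

lemma scaleC_sum: "c *\<^sub>C (\<Sum>i\<in>I. f i) = (\<Sum>i\<in>I. c *\<^sub>C (f i :: 'a::unital_cstar_algebra))"
  by (induction I rule: infinite_finite_induct) (auto simp: scaleC_add_right)

text \<open>The entries of the inverse of the corner isomorphism form the embedding; the trace
  condition holds because that inverse maps 1 to \<open>p\<close>.\<close>

lemma fundamental_groupD:
  fixes \<tau> :: "'a::unital_cstar_algebra \<Rightarrow> complex"
  assumes "t \<in> fundamental_group \<tau>"
  obtains n :: nat and \<psi> :: "'a \<Rightarrow> nat \<Rightarrow> nat \<Rightarrow> 'a" where "t > 0" "cstar_embedding {..<n} \<psi>"
    "cstar_embedding.trace {..<n} \<psi> \<tau> 1 = complex_of_real t"
proof -
  from assms obtain n p \<phi> where t: "t > 0" "complex_of_real t = tensor_Tr \<tau> p"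
    and P: "p \<in> projections n"
    and bij: "bij_betw \<phi> (corner n p) (UNIV :: 'a set)"
    and add: "\<And>x y. x \<in> corner n p \<Longrightarrow> y \<in> corner n p \<Longrightarrow> \<phi> (x + y) = \<phi> x + \<phi> y"
    and mult: "\<And>x y. x \<in> corner n p \<Longrightarrow> y \<in> corner n p \<Longrightarrow> \<phi> (x * y) = \<phi> x * \<phi> y"
    and scale: "\<And>x c. x \<in> corner n p \<Longrightarrow> \<phi> (map_mat (scaleC c) x) = c *\<^sub>C \<phi> x"
    and star: "\<And>x. x \<in> corner n p \<Longrightarrow> \<phi> (mat_star x) = star (\<phi> x)"
    unfolding fundamental_group_def corner_iso_def by blast
  have p: "p \<in> carrier_mat n n" "p * p = p" "mat_star p = p"
    using P by (auto simp: projections_def)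
  note corner = corner_iff[OF P]
  define g where "g = inv_into (corner n p) \<phi>"
  have g: "g x \<in> corner n p" "\<phi> (g x) = x" for x
    using bij by (auto simp: g_def bij_betw_def inv_into_into f_inv_into_f)
  have g_eq: "g x = X" if "X \<in> corner n p" "\<phi> X = x" for x X
    using bij that by (auto simp: g_def bij_betw_def)
  have gc: "g x \<in> carrier_mat n n" "p * g x = g x" "g x * p = g x" for x
    using g(1)[of x] by (auto simp: corner)
  have g_add: "g (x + y) = g x + g y" for x y
  proof (rule g_eq)
    show "g x + g y \<in> corner n p"
      using gc p by (simp add: corner mult_add_distrib_mat[of _ n n _ n] add_mult_distrib_mat[of _ n n _ _ n])
    show "\<phi> (g x + g y) = x + y" by (simp add: add g)
  qed
  have g_mult: "g (x * y) = g x * g y" for x y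
  proof (rule g_eq)
    have "p * (g x * g y) = (p * g x) * g y" "g x * g y * p = g x * (g y * p)"
      using gc(1) p(1) by (simp_all only: assoc_mult_mat[of _ n n _ n _ n])
    then show "g x * g y \<in> corner n p"
      using gc mult_carrier_mat[OF gc(1)[of x] gc(1)[of y]] by (simp add: corner)
    show "\<phi> (g x * g y) = x * y" by (simp add: mult g)
  qed
  have g_scale: "g (c *\<^sub>C x) = map_mat (scaleC c) (g x)" for c x
  proof (rule g_eq)
    have "A * map_mat (scaleC c) B = map_mat (scaleC c) (A * B)"
      "map_mat (scaleC c) A * B = map_mat (scaleC c) (A * B)"
      if "A \<in> carrier_mat n n" "B \<in> carrier_mat n n" for A B :: "'a mat"
      using that
      by (auto intro!: eq_matI simp: scalar_prod_def scaleC_sum mult_scaleC_left mult_scaleC_right)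
    then show "map_mat (scaleC c) (g x) \<in> corner n p" using gc p by (simp add: corner)
    show "\<phi> (map_mat (scaleC c) (g x)) = c *\<^sub>C x" by (simp add: scale g)
  qed
  have g_star: "g (star x) = mat_star (g x)" for x
  proof (rule g_eq)
    have "p * mat_star (g x) = mat_star (g x * p)" "mat_star (g x) * p = mat_star (p * g x)"
      using gc(1)[of x] p by (simp_all add: mat_star_mult)
    then show "mat_star (g x) \<in> corner n p" using gc by (simp add: corner)
    show "\<phi> (mat_star (g x)) = star x" by (simp add: star g)
  qed
  have pc: "p \<in> corner n p" using p by (simp add: corner)
  \<comment> \<open>Unitality of \<open>\<phi>\<close>: the factor \<open>\<phi> (g 1) = 1\<close>
    may be inserted, and \<open>p * g 1 = g 1\<close> because \<open>p\<close> is the unit of the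
    corner.\<close>
  have "\<phi> p = \<phi> (p * g 1)"
    using mult[OF pc g(1)] by (simp add: g)
  then have g1: "g 1 = p" by (intro g_eq pc) (simp add: gc g)
  have dim: "dim_row (g x) = n" "dim_col (g x) = n" for x using gc(1)[of x] by auto
  define \<psi> where "\<psi> x i j = g x $$ (i, j)" for x i j
  have g_index: "g x = index_mat n id (\<psi> x)" for x
    by (rule eq_matI) (auto simp: dim \<psi>_def)
  have id: "bij_betw id {..<n} {..<n}" by simp
  have "cstar_embedding {..<n} \<psi>"
  proof
    show "finite {..<n}" by simp
    fix i j x y c assume "i \<in> {..<n}" "j \<in> {..<n}"
    then show "\<psi> (x + y) i j = \<psi> x i j + \<psi> y i j" "\<psi> (c *\<^sub>C x) i j = c *\<^sub>C \<psi> x i j"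
      "\<psi> (star x) i j = star (\<psi> x j i)"
      "\<psi> (x * y) i j = (\<Sum>k\<in>{..<n}. \<psi> x i k * \<psi> y k j)"
      by (auto simp: \<psi>_def g_add g_scale g_star g_mult dim scalar_prod_def atLeast0LessThan)
  next
    fix x assume "\<And>i j. i \<in> {..<n} \<Longrightarrow> j \<in> {..<n} \<Longrightarrow> \<psi> x i j = 0"
    then have "g x = 0\<^sub>m n n" by (intro eq_matI) (auto simp: dim \<psi>_def)
    moreover have "0\<^sub>m n n \<in> corner n p" using p by (simp add: corner)
    then have "\<phi> (0\<^sub>m n n) = 0"
      using add[of "0\<^sub>m n n" "0\<^sub>m n n"] by simp
    ultimately show "x = 0" using g(2)[of x] by simp
  next
    fix X assume L: "\<And>i j. i \<in> {..<n} \<Longrightarrow> j \<in> {..<n} \<Longrightarrow> (\<Sum>k\<in>{..<n}. \<psi> 1 i k * X k j) = X i j"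
      and R: "\<And>i j. i \<in> {..<n} \<Longrightarrow> j \<in> {..<n} \<Longrightarrow> (\<Sum>k\<in>{..<n}. X i k * \<psi> 1 k j) = X i j"
    have "p * index_mat n id X = index_mat n id X" "index_mat n id X * p = index_mat n id X"
      unfolding g1[symmetric] g_index[of 1] index_mat_mult[OF id]
      by (rule index_mat_cong[OF id L], assumption+, rule index_mat_cong[OF id R], assumption+)
    then have "index_mat n id X \<in> corner n p" by (simp add: corner)
    then have "g (\<phi> (index_mat n id X)) = index_mat n id X"
      by (rule g_eq) (rule refl)
    then have "index_mat n id (\<psi> (\<phi> (index_mat n id X))) = index_mat n id X"
      unfolding g_index .
    then show "\<exists>x. \<forall>i\<in>{..<n}. \<forall>j\<in>{..<n}. \<psi> x i j = X i j"
      using index_mat_inject[OF id] by blast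
  qed
  moreover have "cstar_embedding.trace {..<n} \<psi> \<tau> 1 = complex_of_real t"
    unfolding cstar_embedding.trace_def[OF calculation] t(2)
    using p(1) by (auto simp: tensor_Tr_def \<psi>_def g1)
  ultimately show ?thesis using t(1) by (intro that)
qed

text \<open>An enumeration of \<open>I\<close> turns \<open>\<psi>\<close> into a bijection
  \<open>f\<close> onto a corner of ordinary matrices, whose inverse is the map that
  \<open>corner_iso\<close> asks for. Arbitrary \<open>I\<close> admits the product index sets of
  composites.\<close>

lemma fundamental_groupI:
  fixes \<tau> :: "'a::unital_cstar_algebra \<Rightarrow> complex"
  assumes "cstar_embedding I \<psi>" and t: "t > 0" "cstar_embedding.trace I \<psi> \<tau> 1 = complex_of_real t"
  shows "t \<in> fundamental_group \<tau>"
proof -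
  interpret cstar_embedding I \<psi> by fact
  obtain n :: nat and h where h: "bij_betw h {..<n} I" using ex_index_bij[OF fin] by auto
  define f where "f x = index_mat n h (\<psi> x)" for x
  have P: "f 1 \<in> projections n"
    unfolding f_def by (rule index_mat_projection[OF h]) (simp_all add: one_left one_star)
  note corner = corner_iff[OF P]
  have f_mult: "f (x * y) = f x * f y" for x y
    unfolding f_def index_mat_mult[OF h] by (intro index_mat_cong[OF h] mult)
  have h_in: "h i \<in> I" if "i < n" for i using bij_betwE[OF h] that by auto
  have f_add: "f (x + y) = f x + f y" for x y
    by (rule eq_matI) (auto simp: f_def h_in add)
  have f_scale: "f (c *\<^sub>C x) = map_mat (scaleC c) (f x)" for c x
    by (rule eq_matI) (auto simp: f_def h_in scaleC)
  have f_star: "f (star x) = mat_star (f x)" for x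
    unfolding f_def index_mat_star by (intro index_mat_cong[OF h] star)
  have inj: "inj f"
    by (rule injI, rule eqI, rule index_mat_inject[OF h]) (simp_all add: f_def)
  have range: "range f = corner n (f 1)"
  proof (intro equalityI subsetI)
    fix X assume "X \<in> range f"
    then show "X \<in> corner n (f 1)"
      by (auto simp: corner simp flip: f_mult) (simp add: f_def)
  next
    fix A assume "A \<in> corner n (f 1)"
    then have A: "A \<in> carrier_mat n n" "f 1 * A = A" "A * f 1 = A" by (auto simp: corner)
    obtain X where X: "A = index_mat n h X" using ex_index_mat[OF h A(1)] by blast
    \<comment> \<open>Read through \<open>h\<close>, the equations \<open>f 1 * A = A\<close> and
      \<open>A * f 1 = A\<close> are the premises of \<open>onto\<close>.\<close>
    have "\<exists>x. \<forall>i\<in>I. \<forall>j\<in>I. \<psi> x i j = X i j"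
      using index_mat_inject[OF h A(2)[unfolded X f_def index_mat_mult[OF h]]]
        index_mat_inject[OF h A(3)[unfolded X f_def index_mat_mult[OF h]]]
      by (rule onto)
    then obtain x where "\<And>i j. i \<in> I \<Longrightarrow> j \<in> I \<Longrightarrow> \<psi> x i j = X i j" by blast
    then have "A = f x" unfolding X f_def by (intro index_mat_cong[OF h]) simp
    then show "A \<in> range f" by blast
  qed
  define \<phi> where "\<phi> = inv_into UNIV f"
  have \<phi>f: "\<phi> (f x) = x" for x by (simp add: \<phi>_def inj)
  have "bij_betw \<phi> (corner n (f 1)) UNIV"
    unfolding range[symmetric] \<phi>_def using inj by (intro bij_betw_inv_into) (simp add: bij_betw_def)
  then have "corner_iso n (f 1)"
    unfolding corner_iso_def
    by (intro exI[of _ \<phi>] conjI)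
       (auto simp: range[symmetric] \<phi>f simp flip: f_mult f_add f_scale f_star)
  moreover have "complex_of_real t = tensor_Tr \<tau> (f 1)"
    using t(2) by (simp add: f_def tensor_Tr_index_mat[OF h] trace_def)
  ultimately show ?thesis
    using P t(1) unfolding fundamental_group_def by blast
qed

section \<open>Unit, products and inverses in the fundamental group\<close>

lemma one_in_fundamental_group:
  assumes "unique_tracial_state \<tau>"
  shows "1 \<in> fundamental_group \<tau>"
  by (rule fundamental_groupI[OF cstar_embedding_id])
     (use assms in \<open>simp_all add: cstar_embedding.trace_def[OF cstar_embedding_id]
       unique_tracial_state_def tracial_state_def\<close>)

text \<open>In the trace of the composite unit, \<open>trace_eq\<close> turns each diagonal entry of
  \<open>\<chi> 1\<close> into \<open>t\<close> times its value under \<open>\<tau>\<close>, and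
  these values add up to \<open>s\<close>.\<close>

lemma fundamental_group_mult:
  assumes \<tau>: "unique_tracial_state \<tau>" and s: "s \<in> fundamental_group \<tau>" and t: "t \<in> fundamental_group \<tau>"
  shows "s * t \<in> fundamental_group \<tau>"
proof -
  obtain m :: nat and \<chi> where C: "s > 0" "cstar_embedding {..<m} \<chi>"
      "cstar_embedding.trace {..<m} \<chi> \<tau> 1 = complex_of_real s"
    using fundamental_groupD[OF s] by metis
  obtain n :: nat and \<psi> where P: "t > 0" "cstar_embedding {..<n} \<psi>"
      "cstar_embedding.trace {..<n} \<psi> \<tau> 1 = complex_of_real t"
    using fundamental_groupD[OF t] by metis
  interpret C: cstar_embedding "{..<m}" \<chi> by fact
  interpret P: cstar_embedding "{..<n}" \<psi> by fact
  note PC = cstar_embedding_compose[OF P(2) C(2)]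
  show ?thesis
  proof (rule fundamental_groupI[OF PC])
    show "s * t > 0" using P C by simp
    have "(\<Sum>u\<in>{..<m} \<times> {..<n}. \<tau> (\<psi> (\<chi> 1 (fst u) (fst u)) (snd u) (snd u))) =
        (\<Sum>i<m. P.trace \<tau> (\<chi> 1 i i))"
      by (simp add: P.trace_def sum.cartesian_product case_prod_beta)
    also have "\<dots> = complex_of_real t * C.trace \<tau> 1"
      by (simp add: P.trace_eq[OF \<tau> P(3,1)] C.trace_def sum_distrib_left)
    finally show "cstar_embedding.trace ({..<m} \<times> {..<n})
        (\<lambda>x u v. \<psi> (\<chi> x (fst u) (fst v)) (snd u) (snd v)) \<tau> 1 = complex_of_real (s * t)"
      by (simp add: cstar_embedding.trace_def[OF PC] C(3))
  qed
qed

lemma fundamental_group_inverse: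
  fixes \<tau> :: "'a::unital_cstar_algebra \<Rightarrow> complex"
  assumes simple: "simple_cstar TYPE('a)" and \<tau>: "unique_tracial_state \<tau>"
    and t: "t \<in> fundamental_group \<tau>"
  shows "inverse t \<in> fundamental_group \<tau>"
proof -
  obtain n :: nat and \<psi> where P: "t > 0" "cstar_embedding {..<n} \<psi>"
      "cstar_embedding.trace {..<n} \<psi> \<tau> 1 = complex_of_real t"
    using fundamental_groupD[OF t] by metis
  interpret P: cstar_embedding "{..<n}" \<psi> by fact
  have tr: "tracial_state \<tau>" using \<tau> by (simp add: unique_tracial_state_def)
  \<comment> \<open>A zero diagonal would give trace 0 instead of \<open>t > 0\<close>; simplicity
    is then applied to a nonzero diagonal entry.\<close>
  have "\<exists>i<n. \<psi> 1 i i \<noteq> 0"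
  proof (rule ccontr)
    assume "\<not> (\<exists>i<n. \<psi> 1 i i \<noteq> 0)"
    then have "P.trace \<tau> 1 = 0" by (simp add: P.trace_def tracial_state_zero[OF tr])
    then show False using P(1,3) by simp
  qed
  then obtain i where i: "i \<in> {..<n}" "\<psi> 1 i i \<noteq> 0" by auto
  obtain m :: nat and W where W: "(\<Sum>a<m. \<Sum>k<n. star (W a k) * W a k) = 1"
    "\<And>a k. k \<in> {..<n} \<Longrightarrow> (\<Sum>l<n. \<psi> 1 k l * W a l) = W a k"
    by (rule P.ex_unit_column[OF simple i(1,1,2)], rule that)
  have "\<exists>\<rho>. cstar_embedding {..<m} \<rho> \<and> (\<forall>x. \<forall>a\<in>{..<m}. \<forall>b\<in>{..<m}. \<forall>k\<in>{..<n}. \<forall>l\<in>{..<n}.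
      \<psi> (\<rho> x a b) k l = W a k * x * star (W b l))"
    by (rule P.ex_inverse_embedding[OF finite_lessThan W])
  then obtain \<rho> where \<rho>: "cstar_embedding {..<m} \<rho>"
    "\<And>x a b k l. a \<in> {..<m} \<Longrightarrow> b \<in> {..<m} \<Longrightarrow> k \<in> {..<n} \<Longrightarrow> l \<in> {..<n} \<Longrightarrow>
      \<psi> (\<rho> x a b) k l = W a k * x * star (W b l)"
    by blast
  show ?thesis
  proof (rule fundamental_groupI[OF \<rho>(1)])
    show "inverse t > 0" using P by simp
    \<comment> \<open>By \<open>trace_eq\<close>, \<open>t\<close> times the trace of
      \<open>\<rho> 1\<close> is the trace of \<open>W W\<^sup>*\<close>, which traciality turns
      into the value of \<open>\<tau>\<close> at \<open>W\<^sup>* W = 1\<close>.\<close>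
    have "complex_of_real t * (\<Sum>a<m. \<tau> (\<rho> 1 a a)) = (\<Sum>a<m. P.trace \<tau> (\<rho> 1 a a))"
      by (simp add: P.trace_eq[OF \<tau> P(3,1)] sum_distrib_left)
    also have "\<dots> = (\<Sum>a<m. \<Sum>k<n. \<tau> (W a k * star (W a k)))"
      by (simp add: P.trace_def \<rho>(2))
    also have "\<dots> = (\<Sum>a<m. \<Sum>k<n. \<tau> (star (W a k) * W a k))"
      using tr by (intro sum.cong refl) (auto simp: tracial_state_def)
    also have "\<dots> = \<tau> (\<Sum>a<m. \<Sum>k<n. star (W a k) * W a k)"
      by (simp add: tracial_state_sum[OF tr])
    also have "\<dots> = 1" using tr by (simp add: W(1) tracial_state_def)
    finally show "cstar_embedding.trace {..<m} \<rho> \<tau> 1 = complex_of_real (inverse t)"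
      using P(1) by (simp add: cstar_embedding.trace_def[OF \<rho>(1)] field_simps)
  qed
qed

section \<open>The range of the trace on \<open>K0\<close>\<close>

lemma K0_image_iff:
  assumes "tracial_state \<tau>"
  shows "r \<in> K0_image \<tau> \<longleftrightarrow> (\<exists>p\<in>all_projections. \<exists>q\<in>all_projections.
    r = Re (tensor_Tr \<tau> p) - Re (tensor_Tr \<tau> q))"
proof
  assume "r \<in> K0_image \<tau>"
  then show "\<exists>p\<in>all_projections. \<exists>q\<in>all_projections. r = Re (tensor_Tr \<tau> p) - Re (tensor_Tr \<tau> q)"
    using K0_map_rep[OF assms] by (auto elim!: K0_carrier_cases)
next
  assume "\<exists>p\<in>all_projections. \<exists>q\<in>all_projections. r = Re (tensor_Tr \<tau> p) - Re (tensor_Tr \<tau> q)"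
  then show "r \<in> K0_image \<tau>"
    by (metis K0_carrierI K0_map_rep[OF assms] image_eqI)
qed

lemma K0_image_0: "tracial_state \<tau> \<Longrightarrow> 0 \<in> K0_image \<tau>"
  by (subst K0_image_iff) auto

lemma K0_image_diff:
  assumes "tracial_state \<tau>" "x \<in> K0_image \<tau>" "y \<in> K0_image \<tau>"
  shows "x - y \<in> K0_image \<tau>"
proof -
  obtain p q p' q' where *: "p \<in> all_projections" "q \<in> all_projections" "p' \<in> all_projections"
      "q' \<in> all_projections" "x = Re (tensor_Tr \<tau> p) - Re (tensor_Tr \<tau> q)"
      "y = Re (tensor_Tr \<tau> p') - Re (tensor_Tr \<tau> q')"
    using assms(2,3) unfolding K0_image_iff[OF assms(1)] by blast
  \<comment> \<open>These block sums represent the difference of the classes of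
    \<open>(p, q)\<close> and \<open>(p', q')\<close>.\<close>
  have "x - y = Re (tensor_Tr \<tau> (p \<oplus>\<^sub>m q')) - Re (tensor_Tr \<tau> (q \<oplus>\<^sub>m p'))"
    using * by (simp add: tensor_Tr_block_sum all_projections_iff)
  then show ?thesis
    unfolding K0_image_iff[OF assms(1)] using * all_projections_block_sum by blast
qed

lemma fundamental_group_subset_K0_image:
  assumes "tracial_state \<tau>"
  shows "fundamental_group \<tau> \<subseteq> K0_image \<tau>"
proof
  fix t assume "t \<in> fundamental_group \<tau>"
  then obtain n p where "p \<in> projections n" "complex_of_real t = tensor_Tr \<tau> p"
    by (auto simp: fundamental_group_def)
  \<comment> \<open>The empty matrix represents the zero of \<open>K0\<close>, and its trace is an
    empty sum.\<close>
  then have "p \<in> all_projections" "t = Re (tensor_Tr \<tau> p) - Re (tensor_Tr \<tau> (0\<^sub>m 0 0))"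
    by (auto simp: all_projections_def tensor_Tr_def dest: arg_cong[of _ _ Re])
  then show "t \<in> K0_image \<tau>" unfolding K0_image_iff[OF assms] by blast
qed

text \<open>Applying \<open>\<psi>\<close> entrywise preserves products and adjoints of matrices, so
  \<open>p\<close> becomes a projection indexed by pairs; \<open>trace_eq\<close> on the diagonal
  entries gives the factor \<open>t\<close>.\<close>

lemma amplified_projection:
  assumes \<tau>: "unique_tracial_state \<tau>" and t: "t \<in> fundamental_group \<tau>" and p: "p \<in> all_projections"
  shows "\<exists>q\<in>all_projections. tensor_Tr \<tau> q = complex_of_real t * tensor_Tr \<tau> p"
proof -
  obtain n :: nat and \<psi> where P: "t > 0" "cstar_embedding {..<n} \<psi>"
      "cstar_embedding.trace {..<n} \<psi> \<tau> 1 = complex_of_real t"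
    using fundamental_groupD[OF t] by metis
  interpret P: cstar_embedding "{..<n}" \<psi> by fact
  define m where "m = dim_row p"
  have pp: "p * p = p" "mat_star p = p" "dim_col p = m" "dim_row p = m"
    using p by (auto simp: all_projections_iff m_def)
  have p_mult: "(\<Sum>k<m. p $$ (i, k) * p $$ (k, j)) = p $$ (i, j)" if "i < m" "j < m" for i j
  proof -
    have "(p * p) $$ (i, j) = (\<Sum>k<m. p $$ (i, k) * p $$ (k, j))"
      using that by (simp add: pp(3,4) scalar_prod_def atLeast0LessThan)
    then show ?thesis by (simp add: pp(1))
  qed
  have p_star: "star (p $$ (j, i)) = p $$ (i, j)" if "i < m" "j < m" for i j
    using mat_star_index[of i p j] pp that by simp
  let ?X = "\<lambda>u v. \<psi> (p $$ (fst u, fst v)) (snd u) (snd v)"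
  obtain N :: nat and h where h: "bij_betw h {..<N} ({..<m} \<times> {..<n})"
    using ex_index_bij[of "{..<m} \<times> {..<n}"] by auto
  have "index_mat N h ?X \<in> projections N"
  proof (rule index_mat_projection[OF h]; clarsimp)
    fix i j k l assume *: "i < m" "j < m" "k < n" "l < n"
    have "(\<Sum>w\<in>{..<m} \<times> {..<n}. \<psi> (p $$ (i, fst w)) k (snd w) * \<psi> (p $$ (fst w, j)) (snd w) l) =
        \<psi> (\<Sum>a<m. p $$ (i, a) * p $$ (a, j)) k l"
      using * by (simp add: P.sum P.mult sum.cartesian_product case_prod_beta)
    then show "(\<Sum>w\<in>{..<m} \<times> {..<n}. \<psi> (p $$ (i, fst w)) k (snd w) * \<psi> (p $$ (fst w, j)) (snd w) l) =
        \<psi> (p $$ (i, j)) k l"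
      using * by (simp add: p_mult)
    show "star (\<psi> (p $$ (j, i)) l k) = \<psi> (p $$ (i, j)) k l"
      using * by (simp add: p_star flip: P.star)
  qed
  moreover have "tensor_Tr \<tau> (index_mat N h ?X) = (\<Sum>i<m. P.trace \<tau> (p $$ (i, i)))"
    by (simp add: tensor_Tr_index_mat[OF h] P.trace_def sum.cartesian_product case_prod_beta)
  then have "tensor_Tr \<tau> (index_mat N h ?X) = complex_of_real t * tensor_Tr \<tau> p"
    by (simp add: P.trace_eq[OF \<tau> P(3,1)] tensor_Tr_def pp sum_distrib_left)
  ultimately show ?thesis unfolding all_projections_def by blast
qed

lemma fundamental_group_K0_image_mult:
  assumes \<tau>: "unique_tracial_state \<tau>" and t: "t \<in> fundamental_group \<tau>" and x: "x \<in> K0_image \<tau>"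
  shows "t * x \<in> K0_image \<tau>"
proof -
  have tr: "tracial_state \<tau>" using \<tau> by (simp add: unique_tracial_state_def)
  obtain p q where pq: "p \<in> all_projections" "q \<in> all_projections"
      "x = Re (tensor_Tr \<tau> p) - Re (tensor_Tr \<tau> q)"
    using x unfolding K0_image_iff[OF tr] by blast
  obtain p' q' where "p' \<in> all_projections" "tensor_Tr \<tau> p' = complex_of_real t * tensor_Tr \<tau> p"
      "q' \<in> all_projections" "tensor_Tr \<tau> q' = complex_of_real t * tensor_Tr \<tau> q"
    using amplified_projection[OF \<tau> t] pq(1,2) by metis
  moreover from this have "t * x = Re (tensor_Tr \<tau> p') - Re (tensor_Tr \<tau> q')"
    by (simp add: pq(3) right_diff_distrib)
  ultimately show ?thesis unfolding K0_image_iff[OF tr] by blast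
qed

theorem proposition3p7:
  fixes \<tau> :: "'a::unital_cstar_algebra \<Rightarrow> complex"
  assumes "simple_cstar TYPE('a)"
    and "unique_tracial_state \<tau>"
  shows "fundamental_group \<tau> \<subseteq> pos_inner_multipliers (K0_image \<tau>) \<and>
         pos_inner_multipliers (K0_image \<tau>)
           \<subseteq> K0_image \<tau> \<inter> inverse ` (K0_image \<tau> - {0}) \<inter> {0<..} \<and>
         module (int_group_ring (mult_reals (fundamental_group \<tau>))) (real_module (K0_image \<tau>))"
proof (intro conjI)
  let ?F = "fundamental_group \<tau>" and ?E = "K0_image \<tau>"
  have tr: "tracial_state \<tau>" using assms by (simp add: unique_tracial_state_def)
  note FE = fundamental_group_K0_image_mult[OF assms(2)]
  have pos: "t > 0" if "t \<in> ?F" for t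
    using that by (simp add: fundamental_group_def)
  show "?F \<subseteq> pos_inner_multipliers ?E"
  proof
    fix t assume t: "t \<in> ?F"
    then have inv: "inverse t \<in> ?F" by (rule fundamental_group_inverse[OF assms])
    \<comment> \<open>Since \<open>inverse t\<close> also lies in the fundamental group,
      \<open>inverse t * x\<close> is in the range of the trace, and \<open>t\<close> carries it to
      \<open>x\<close>. This upgrades the inclusion to equality.\<close>
    have "x \<in> (*) t ` ?E" if "x \<in> ?E" for x
      using FE[OF inv that] pos[OF t] by (intro image_eqI[of _ _ "inverse t * x"]) auto
    then have "(*) t ` ?E = ?E" using FE[OF t] by blast
    then show "t \<in> pos_inner_multipliers ?E"
      using t inv pos[OF t] fundamental_group_subset_K0_image[OF tr]
      by (auto simp: pos_inner_multipliers_def inner_multipliers_def)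
  qed
  show "pos_inner_multipliers ?E \<subseteq> ?E \<inter> inverse ` (?E - {0}) \<inter> {0<..}"
  proof
    fix t assume "t \<in> pos_inner_multipliers ?E"
    then have t: "t \<in> ?E" "inverse t \<in> ?E - {0}" "t > 0"
      by (auto simp: pos_inner_multipliers_def inner_multipliers_def)
    then have "t \<in> inverse ` (?E - {0})"
      by (intro image_eqI[of _ _ "inverse t"]) auto
    with t show "t \<in> ?E \<inter> inverse ` (?E - {0}) \<inter> {0<..}" by blast
  qed
  show "module (int_group_ring (mult_reals ?F)) (real_module ?E)"
    by (intro module_real_module one_in_fundamental_group fundamental_group_mult assms
        K0_image_0 K0_image_diff tr FE)
qed

end
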